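(* Let $\mathcal{A}:L_2(\Omega_A)^G\to\prod_{\ell=1}^LL_2(\Omega_\ell,\gamma_\ell)$ be the operator $$\mathcal{A}\varphi:=(2T)\sum_{j,k\in\mathbb{Z}}\sum_{g=1}^G\left(\frac{\sqrt{\gamma_\ell}}{c_{\ell,g}\,\sigma_g^2}\,w_{jk}\Big(-\frac{\alpha_gh_\ell}{c_{\ell,g}}\Big)\,\langle\varphi_g,w_{jk}\rangle_{L_2(\Omega_A)}\,\widetilde w_{jk,\ell g}\right)_{\ell=1}^L,\qquad \sigma_g:=\sqrt{\sum_{\ell=1}^L\gamma_\ell\,c_{\ell,g}^{-2}},$$ where $\widetilde w_{jk,\ell g}$ are the dual frame functions of the frame $\{w_{jk,\ell g}\}_{j,k\in\mathbb{Z},\,g=1,\dots,G}$ over $L_2(\Omega_\ell,\gamma_\ell)$, and let $\varphi=(\varphi_g)_{g=1}^G\in L_2(\Omega_A)^G$. Then $$(\mathcal{A}\varphi)(r)=\sum_{g=1}^G\left(\frac{\gamma_\ell}{(c_{\ell,g}\sigma_g)^2}\,\varphi_g\Big(\frac{r-\alpha_gh_\ell}{c_{\ell,g}}\Big)\,\frac{I_{\Omega_A(\alpha_gh_\ell)}(r)}{O_\ell(r)}\right)_{\ell=1}^L=\sum_{g=1}^G\left(\frac{1}{\sigma_g^2\,O_\ell(r)}\,(A_g^\ast\varphi_g)_\ell(r)\right)_{\ell=1}^L,$$ where $A_g^\ast$ is the adjoint of the $g$-th component $A_g:\prod_{\ell=1}^LL_2(\Omega_\ell,\gamma_\ell)\to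 L_2(\Omega_A)$ of the atmospheric tomography operator, and $(A_g^\ast\varphi_g)_\ell$ is its $\ell$-th component.
   Context: Let $\Omega_A\subset\mathbb{R}^2$ be a domain (telescope aperture), $L,G\in\mathbb{N}$, $0\le h_1<\dots<h_L$ (layer heights), $\alpha_g=(\alpha_g^x,\alpha_g^y)\in\mathbb{R}^2$ for $g=1,\dots,G$ (guide star directions), and $\gamma_\ell>0$ with $\sum_{\ell=1}^L\gamma_\ell=1$ (turbulence weights). Let $G=G_{\mathrm{NGS}}+G_{\mathrm{LGS}}$, let $h_{\mathrm{LGS}}>h_\ell$ for all $\ell$, and put $c_{\ell,g}=1$ for $g\le G_{\mathrm{NGS}}$ and $c_{\ell,g}=1-h_\ell/h_{\mathrm{LGS}}$ for $g>G_{\mathrm{NGS}}$, so $c_{\ell,g}\in(0,1]$; put $c_\ell:=\min_gc_{\ell,g}$. Define $$\Omega_A(\alpha_gh_\ell):=\Big\{r\in\mathbb{R}^2\ \Big|\ \frac{r-\alpha_gh_\ell}{c_{\ell,g}}\in\Omega_A\Big\},\qquad \Omega_\ell:=\bigcup_{g=1}^G\Omega_A(\alpha_gh_\ell).$$ Let $\Omega_T=[-T,T]^2$ with $T>0$ sufficiently large that for all $g,\ell$: $\Omega_A+\alpha_gh_\ell\subset c_\ell\Omega_T$, $\Omega_A\subset\Omega_T$, and $\Omega_A(\alpha_gh_\ell)\subset c_{\ell,g}\Omega_T$. $L_2(\Omega_\ell,\gamma_\ell)$ is the (complex) space $L_2(\Omega_\ell)$ with inner product $\langle u,v\rangle_{L_2(\Omega_\ell,\gamma_\ell)}=\frac1{\gamma_\ell}\int_{\Omega_\ell}u\overline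 v\,\mathrm{d}r$; product spaces carry the sum of the componentwise inner products, and $L_2(\Omega_A)$ its standard inner product $\int_{\Omega_A}u\overline v\,\mathrm{d}r$. Pointwise identities between $L_2$ functions are understood almost everywhere (for the $\ell$-th component: for almost every $r\in\Omega_\ell$); a term containing an indicator function is $0$ where the indicator vanishes. Series over $j,k$ converge in $L_2(\Omega_\ell,\gamma_\ell)$. The atmospheric tomography operator is $$A:\mathcal{D}(A):=\prod_{\ell=1}^LL_2(\Omega_\ell,\gamma_\ell)\to L_2(\Omega_A)^G,\qquad A\phi=(A_g\phi)_{g=1}^G,\qquad(A_g\phi)(r):=\sum_{\ell=1}^L\phi_\ell(c_{\ell,g}r+\alpha_gh_\ell).$$ Let $I_{\ell g}=I_{\Omega_A(\alpha_gh_\ell)}$ be the indicator function of $\Omega_A(\alpha_gh_\ell)$ and $O_\ell(r):=\sum_{g=1}^GI_{\ell g}(r)$ the overlay function. For $j,k\in\mathbb{Z}$ put $$w_{jk}(x,y):=\frac1{2T}e^{i\omega(jx+ky)},\ \ \omega=\frac\pi T,\qquad w_{jk,\ell g}(x,y):=\frac{\sqrt{\gamma_\ell}}{c_{\ell,g}}\,w_{jk}\big((x,y)/c_{\ell,g}\big)\,I_{\ell g}(x,y).$$ For a frame $\{e_k\}_{k\in K}$ over a Hilbert space $H$ (i.e. there are $0<A\le B<\infty$ with $A\|f\|^2\le\sum_k|\langle f,e_k\rangle|^2\le B\|f\|^2$ for all $f\in H$), the operator $Sf:=\sum_{k\in K}\langle f,e_k\rangle e_k$ is continuously invertible on $H$,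 and the dual frame is $\{\widetilde e_k\}_{k\in K}$ with $\widetilde e_k:=S^{-1}e_k$. It is known that $\{w_{jk,\ell g}\}_{j,k\in\mathbb{Z},\,g=1,\dots,G}$ is a frame over $L_2(\Omega_\ell,\gamma_\ell)$ and that $\mathcal{A}$ is well-defined and bounded. *)

theory Defs
  imports "HOL-Analysis.Analysis"
begin

section \<open>Weighted spaces of square-integrable functions\<close>

text \<open>
  Elements of \<open>L\<^sub>2\<close> are represented by functions on the whole ambient space; only their values
  on \<open>\<Omega>\<close>, up to null sets, are relevant. Hence objects which are unique as elements of \<open>L\<^sub>2\<close>
  (limits, preimages, adjoints) are unique here up to equality almost everywhere on \<open>\<Omega>\<close>, and are
  introduced by choosing a representative.
\<close>

definition L2 :: "'a::euclidean_space set \<Rightarrow> ('a \<Rightarrow> complex) set" where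
  "L2 \<Omega> = {f. f \<in> borel_measurable (lebesgue_on \<Omega>) \<and>
              integrable (lebesgue_on \<Omega>) (\<lambda>x. (cmod (f x))\<^sup>2)}"

definition L2_inner ::
    "'a::euclidean_space set \<Rightarrow> real \<Rightarrow> ('a \<Rightarrow> complex) \<Rightarrow> ('a \<Rightarrow> complex) \<Rightarrow> complex" where
  "L2_inner \<Omega> \<gamma> u v = of_real (1 / \<gamma>) * (LINT x|lebesgue_on \<Omega>. u x * cnj (v x))"

definition L2_norm :: "'a::euclidean_space set \<Rightarrow> real \<Rightarrow> ('a \<Rightarrow> complex) \<Rightarrow> real" where
  "L2_norm \<Omega> \<gamma> u = sqrt (Re (L2_inner \<Omega> \<gamma> u u))"

text \<open>Unconditional convergence in \<open>L\<^sub>2(\<Omega>, \<gamma>)\<close>, as for \<open>has_sum\<close>.\<close>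

definition L2_has_sum ::
    "'a::euclidean_space set \<Rightarrow> real \<Rightarrow> ('k \<Rightarrow> 'a \<Rightarrow> complex) \<Rightarrow> ('a \<Rightarrow> complex) \<Rightarrow> 'k set \<Rightarrow> bool" where
  "L2_has_sum \<Omega> \<gamma> f s K \<longleftrightarrow>
     (\<forall>k\<in>K. f k \<in> L2 \<Omega>) \<and> s \<in> L2 \<Omega> \<and>
     ((\<lambda>F. L2_norm \<Omega> \<gamma> (\<lambda>x. (\<Sum>k\<in>F. f k x) - s x)) \<longlongrightarrow> 0) (finite_subsets_at_top K)"

definition L2_infsum ::
    "'a::euclidean_space set \<Rightarrow> real \<Rightarrow> ('k \<Rightarrow> 'a \<Rightarrow> complex) \<Rightarrow> 'k set \<Rightarrow> 'a \<Rightarrow> complex" where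
  "L2_infsum \<Omega> \<gamma> f K = (SOME s. L2_has_sum \<Omega> \<gamma> f s K)"

definition frame_operator ::
    "'a::euclidean_space set \<Rightarrow> real \<Rightarrow> ('k \<Rightarrow> 'a \<Rightarrow> complex) \<Rightarrow> 'k set \<Rightarrow>
     ('a \<Rightarrow> complex) \<Rightarrow> 'a \<Rightarrow> complex" where
  "frame_operator \<Omega> \<gamma> e K f = L2_infsum \<Omega> \<gamma> (\<lambda>k x. L2_inner \<Omega> \<gamma> f (e k) * e k x) K"

text \<open>
  For a frame \<open>e\<close> indexed by \<open>K\<close> the frame operator \<open>S\<close> is invertible, and the following chooses a
  representative of \<open>S\<^sup>-\<^sup>1 (e k)\<close>.
\<close>

definition dual_frame ::
    "'a::euclidean_space set \<Rightarrow> real \<Rightarrow> ('k \<Rightarrow> 'a \<Rightarrow> complex) \<Rightarrow> 'k set \<Rightarrow> 'k \<Rightarrow> 'a \<Rightarrow> complex" where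
  "dual_frame \<Omega> \<gamma> e K k =
     (SOME f. f \<in> L2 \<Omega> \<and> (AE x in lebesgue_on \<Omega>. frame_operator \<Omega> \<gamma> e K f x = e k x))"

text \<open>
  The adjoint of \<open>B : X \<rightarrow> Y\<close> with respect to the inner products \<open>ipX\<close>, \<open>ipY\<close>; the library's
  \<open>adjoint\<close> covers only real inner product types.
\<close>

definition adjoint_wrt ::
    "'x set \<Rightarrow> ('x \<Rightarrow> 'x \<Rightarrow> complex) \<Rightarrow> ('y \<Rightarrow> 'y \<Rightarrow> complex) \<Rightarrow> ('x \<Rightarrow> 'y) \<Rightarrow> 'y \<Rightarrow> 'x" where
  "adjoint_wrt X ipX ipY B y = (SOME x. x \<in> X \<and> (\<forall>z\<in>X. ipY (B z) y = ipX z x))"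


section \<open>Atmospheric tomography\<close>

text \<open>Layers are indexed by \<open>{1..layers P}\<close> and guide stars by \<open>{1..stars P}\<close>, natural ones first.\<close>

record tomography =
  aperture :: "(real \<times> real) set"
  layers :: nat
  ngs :: nat
  lgs :: nat
  height :: "nat \<Rightarrow> real"
  direction :: "nat \<Rightarrow> real \<times> real"
  weight :: "nat \<Rightarrow> real"
  lgs_height :: real
  halfwidth :: real

definition stars :: "tomography \<Rightarrow> nat" where
  "stars P = ngs P + lgs P"

definition cone_factor :: "tomography \<Rightarrow> nat \<Rightarrow> nat \<Rightarrow> real" where
  "cone_factor P l g = (if g \<le> ngs P then 1 else 1 - height P l / lgs_height P)"

definition min_cone_factor :: "tomography \<Rightarrow> nat \<Rightarrow> real" where
  "min_cone_factor P l = Min (cone_factor P l ` {1..stars P})"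

definition shifted_aperture :: "tomography \<Rightarrow> nat \<Rightarrow> nat \<Rightarrow> (real \<times> real) set" where
  "shifted_aperture P l g =
     {r. (r - height P l *\<^sub>R direction P g) /\<^sub>R cone_factor P l g \<in> aperture P}"

definition layer_domain :: "tomography \<Rightarrow> nat \<Rightarrow> (real \<times> real) set" where
  "layer_domain P l = (\<Union>g\<in>{1..stars P}. shifted_aperture P l g)"

definition square :: "tomography \<Rightarrow> (real \<times> real) set" where
  "square P = {-halfwidth P..halfwidth P} \<times> {-halfwidth P..halfwidth P}"

locale tomography_setting =
  fixes P :: tomography
  assumes aperture_domain: "open (aperture P)" "connected (aperture P)" "aperture P \<noteq> {}"
    and stars_pos: "1 \<le> stars P"
    and height_nonneg: "0 \<le> height P 1"
    and height_less: "\<And>l m. 1 \<le> l \<Longrightarrow> l < m \<Longrightarrow> m \<le> layers P \<Longrightarrow> height P l < height P m"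
    and weight_pos: "\<And>l. l \<in> {1..layers P} \<Longrightarrow> 0 < weight P l"
    and weight_sum: "(\<Sum>l = 1..layers P. weight P l) = 1" \<comment> \<open>so there is at least one layer\<close>
    and lgs_above: "\<And>l. l \<in> {1..layers P} \<Longrightarrow> height P l < lgs_height P"
    and halfwidth_pos: "0 < halfwidth P"
    and aperture_subset: "aperture P \<subseteq> square P"
    and translate_subset: "\<And>l g. l \<in> {1..layers P} \<Longrightarrow> g \<in> {1..stars P} \<Longrightarrow>
      (\<lambda>r. r + height P l *\<^sub>R direction P g) ` aperture P \<subseteq> (\<lambda>r. min_cone_factor P l *\<^sub>R r) ` square P"
    and shifted_subset: "\<And>l g. l \<in> {1..layers P} \<Longrightarrow> g \<in> {1..stars P} \<Longrightarrow>
      shifted_aperture P l g \<subseteq> (\<lambda>r. cone_factor P l g *\<^sub>R r) ` square P"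

definition layer_space :: "tomography \<Rightarrow> (nat \<Rightarrow> real \<times> real \<Rightarrow> complex) set" where
  "layer_space P = {\<psi>. \<forall>l\<in>{1..layers P}. \<psi> l \<in> L2 (layer_domain P l)}"

definition layer_inner ::
    "tomography \<Rightarrow> (nat \<Rightarrow> real \<times> real \<Rightarrow> complex) \<Rightarrow> (nat \<Rightarrow> real \<times> real \<Rightarrow> complex) \<Rightarrow> complex" where
  "layer_inner P \<psi> \<eta> = (\<Sum>l = 1..layers P. L2_inner (layer_domain P l) (weight P l) (\<psi> l) (\<eta> l))"

text \<open>The standard inner product on the aperture has weight 1.\<close>

definition aperture_inner ::
    "tomography \<Rightarrow> (real \<times> real \<Rightarrow> complex) \<Rightarrow> (real \<times> real \<Rightarrow> complex) \<Rightarrow> complex" where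
  "aperture_inner P = L2_inner (aperture P) 1"

definition data_space :: "tomography \<Rightarrow> (nat \<Rightarrow> real \<times> real \<Rightarrow> complex) set" where
  "data_space P = {\<phi>. \<forall>g\<in>{1..stars P}. \<phi> g \<in> L2 (aperture P)}"

text \<open>The component \<open>A\<^sub>g\<close> of the atmospheric tomography operator, and its adjoint.\<close>

definition tomography_op ::
    "tomography \<Rightarrow> nat \<Rightarrow> (nat \<Rightarrow> real \<times> real \<Rightarrow> complex) \<Rightarrow> real \<times> real \<Rightarrow> complex" where
  "tomography_op P g \<psi> r =
     (\<Sum>l = 1..layers P. \<psi> l (cone_factor P l g *\<^sub>R r + height P l *\<^sub>R direction P g))"

definition tomography_adj ::
    "tomography \<Rightarrow> nat \<Rightarrow> (real \<times> real \<Rightarrow> complex) \<Rightarrow> nat \<Rightarrow> real \<times> real \<Rightarrow> complex" where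
  "tomography_adj P g =
     adjoint_wrt (layer_space P) (layer_inner P) (aperture_inner P) (tomography_op P g)"

definition overlay :: "tomography \<Rightarrow> nat \<Rightarrow> real \<times> real \<Rightarrow> real" where
  "overlay P l r = (\<Sum>g = 1..stars P. indicator (shifted_aperture P l g) r)"

definition wave :: "tomography \<Rightarrow> int \<Rightarrow> int \<Rightarrow> real \<times> real \<Rightarrow> complex" where
  "wave P j k = (\<lambda>(x, y). of_real (1 / (2 * halfwidth P)) *
     exp (\<i> * of_real (pi / halfwidth P * (of_int j * x + of_int k * y))))"

definition layer_wave ::
    "tomography \<Rightarrow> nat \<Rightarrow> int \<times> int \<times> nat \<Rightarrow> real \<times> real \<Rightarrow> complex" where
  "layer_wave P l = (\<lambda>(j, k, g) r. of_real (sqrt (weight P l) / cone_factor P l g) *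
     wave P j k (r /\<^sub>R cone_factor P l g) * indicator (shifted_aperture P l g) r)"

definition dual_layer_wave ::
    "tomography \<Rightarrow> nat \<Rightarrow> int \<times> int \<times> nat \<Rightarrow> real \<times> real \<Rightarrow> complex" where
  "dual_layer_wave P l =
     dual_frame (layer_domain P l) (weight P l) (layer_wave P l) (UNIV \<times> UNIV \<times> {1..stars P})"

definition star_sigma :: "tomography \<Rightarrow> nat \<Rightarrow> real" where
  "star_sigma P g = sqrt (\<Sum>l = 1..layers P. weight P l * cone_factor P l g powi (-2))"

text \<open>
  The operator from \<open>data_space P\<close> to \<open>layer_space P\<close> given by the dual frames. Its series is
  summed in each component separately, over the pairs \<open>(j, k)\<close>.
\<close>

definition reconstruction ::
    "tomography \<Rightarrow> (nat \<Rightarrow> real \<times> real \<Rightarrow> complex) \<Rightarrow> nat \<Rightarrow> real \<times> real \<Rightarrow> complex" where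
  "reconstruction P \<phi> l r = of_real (2 * halfwidth P) *
     L2_infsum (layer_domain P l) (weight P l)
       (\<lambda>(j, k) x. \<Sum>g = 1..stars P.
          of_real (sqrt (weight P l) / (cone_factor P l g * (star_sigma P g)\<^sup>2)) *
          wave P j k (- ((height P l *\<^sub>R direction P g) /\<^sub>R cone_factor P l g)) *
          aperture_inner P (\<phi> g) (wave P j k) *
          dual_layer_wave P l (j, k, g) x)
       UNIV r"

end

theory Submission
  imports Defs
begin

text \<open>
  Fix a layer with domain \<open>\<Omega>\<close>, weight \<open>\<gamma>\<close> and overlay function \<open>O\<close>, and write \<open>c\<close>, \<open>a\<close>, \<open>I\<close> for the
  dilation factor, the translation vector and the indicator function of the shifted aperture that
  belong to a guide star.

  The waves \<open>w\<^sub>j\<^sub>k\<close> are an orthonormal basis of \<open>L\<^sub>2\<close> of the square. The shifted aperture is contained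
  in the square dilated by \<open>c\<close>, so the dilated waves expand every function that lives on it. The factors
  in \<open>layer_wave\<close> are chosen such that this expansion reads
  \<open>\<Sum>\<^sub>j\<^sub>k \<langle>f, w\<^sub>j\<^sub>k\<^sub>,\<^sub>g\<rangle> w\<^sub>j\<^sub>k\<^sub>,\<^sub>g = f I\<close> (lemma \<open>layer_wave_expansion\<close>). Summation over the guide stars
  shows that the frame operator is multiplication by \<open>O\<close> (lemma \<open>layer_frame_expansion\<close>). As \<open>O \<ge> 1\<close>
  on \<open>\<Omega>\<close>, its inverse is division by \<open>O\<close>, and the dual frame is \<open>w\<^sub>j\<^sub>k\<^sub>,\<^sub>g / O\<close>
  (lemma \<open>dual_layer_wave_eq\<close>).

  With the dual frame known, the identity \<open>2 T w\<^sub>j\<^sub>k(-a/c) w\<^sub>j\<^sub>k(r/c) = w\<^sub>j\<^sub>k((r - a)/c)\<close> turns the series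
  of each guide star into the expansion of \<open>\<phi>\<^sub>g\<close> at \<open>(r - a)/c\<close>, up to the factors in the claim
  (lemma \<open>reconstruction_eq\<close>). The substitution \<open>r = c s + a\<close> shows that the adjoint of the \<open>g\<close>-th
  component maps \<open>f\<close> to \<open>(\<gamma> / c\<^sup>2) f((r - a)/c) I(r)\<close> (lemma \<open>explicit_adj_inner\<close>), which is the
  second form of the result.

  The analytic core is the completeness of the waves (lemma \<open>wave_expansion\<close>). Partial sums of an
  orthonormal expansion are best approximations, so it is enough that trigonometric polynomials are
  dense in \<open>L\<^sub>2\<close> of the square. Truncation reduces this to bounded functions; a bounded measurable function
  is an almost everywhere limit of uniformly bounded continuous functions, and these can be cut off such
  that they become functions on the torus, where the theorem of Stone and Weierstrass applies.
\<close>

section \<open>Square-integrable functions\<close>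

text \<open>
  The square of the norm turns all estimates into inequalities between integrals. As they only serve
  to show convergence to \<open>0\<close>, the bound \<open>\<parallel>f + g\<parallel>\<^sup>2 \<le> 2 \<parallel>f\<parallel>\<^sup>2 + 2 \<parallel>g\<parallel>\<^sup>2\<close> can replace the triangle
  inequality.
\<close>

definition L2_sqnorm :: "'a::euclidean_space set \<Rightarrow> ('a \<Rightarrow> complex) \<Rightarrow> real" where
  "L2_sqnorm \<Omega> f = (LINT x|lebesgue_on \<Omega>. (cmod (f x))\<^sup>2)"

lemma L2_sqnorm_nonneg: "0 \<le> L2_sqnorm \<Omega> f"
  by (simp add: L2_sqnorm_def)

lemma L2_measurable: "f \<in> L2 \<Omega> \<Longrightarrow> f \<in> borel_measurable (lebesgue_on \<Omega>)"
  by (simp add: L2_def)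

lemma L2_integrable_square: "f \<in> L2 \<Omega> \<Longrightarrow> integrable (lebesgue_on \<Omega>) (\<lambda>x. (cmod (f x))\<^sup>2)"
  by (simp add: L2_def)

lemma L2_inner_self: "L2_inner \<Omega> \<gamma> f f = of_real (L2_sqnorm \<Omega> f / \<gamma>)"
proof -
  have "L2_inner \<Omega> \<gamma> f f = of_real (1 / \<gamma>) * (LINT x|lebesgue_on \<Omega>. of_real ((cmod (f x))\<^sup>2))"
    unfolding L2_inner_def by (simp add: complex_norm_square[symmetric] del: of_real_power)
  then show ?thesis
    unfolding L2_sqnorm_def by (simp add: integral_complex_of_real del: of_real_power)
qed

lemma L2_norm_eq: "L2_norm \<Omega> \<gamma> f = sqrt (L2_sqnorm \<Omega> f / \<gamma>)"
  unfolding L2_norm_def L2_inner_self by (simp only: Re_complex_of_real)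

text \<open>
  Monotonicity of the integral. It is the source of the operator bounds for multiplication by a bounded
  function, in particular for division by the overlay function.
\<close>

lemma L2_dominated:
  assumes "f \<in> borel_measurable (lebesgue_on \<Omega>)" "g \<in> L2 \<Omega>"
    "AE x in lebesgue_on \<Omega>. cmod (f x) \<le> B * cmod (g x)"
  shows "f \<in> L2 \<Omega>" "L2_sqnorm \<Omega> f \<le> B\<^sup>2 * L2_sqnorm \<Omega> g"
proof -
  have le: "AE x in lebesgue_on \<Omega>. (cmod (f x))\<^sup>2 \<le> B\<^sup>2 * (cmod (g x))\<^sup>2"
    using assms(3)
    by eventually_elim (metis norm_ge_zero power_mono power_mult_distrib)
  have ig: "integrable (lebesgue_on \<Omega>) (\<lambda>x. B\<^sup>2 * (cmod (g x))\<^sup>2)"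
    using L2_integrable_square[OF assms(2)] by simp
  have i: "integrable (lebesgue_on \<Omega>) (\<lambda>x. (cmod (f x))\<^sup>2)"
    using assms(1) le by (intro Bochner_Integration.integrable_bound[OF ig]) auto
  show "f \<in> L2 \<Omega>" using i assms(1) by (simp add: L2_def)
  show "L2_sqnorm \<Omega> f \<le> B\<^sup>2 * L2_sqnorm \<Omega> g"
    unfolding L2_sqnorm_def using integral_mono_AE[OF i ig le] by simp
qed

lemma L2_zero [simp]: "(\<lambda>x. 0) \<in> L2 \<Omega>"
  by (simp add: L2_def)

lemma L2_cmult: "f \<in> L2 \<Omega> \<Longrightarrow> (\<lambda>x. c * f x) \<in> L2 \<Omega>"
  by (rule L2_dominated(1)[where g = f and B = "cmod c"])
    (auto simp: norm_mult intro: borel_measurable_times L2_measurable)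

lemma norm_add_square_le: "(cmod (a + b))\<^sup>2 \<le> 2 * (cmod a)\<^sup>2 + 2 * (cmod b)\<^sup>2"
proof -
  have "(cmod (a + b))\<^sup>2 \<le> (cmod a + cmod b)\<^sup>2"
    by (simp add: norm_triangle_ineq power_mono)
  also have "\<dots> \<le> 2 * (cmod a)\<^sup>2 + 2 * (cmod b)\<^sup>2"
    using sum_squares_bound[of "cmod a" "cmod b"] by (simp add: power2_sum)
  finally show ?thesis .
qed

lemma L2_add:
  assumes "f \<in> L2 \<Omega>" "g \<in> L2 \<Omega>"
  shows "(\<lambda>x. f x + g x) \<in> L2 \<Omega>"
    and "L2_sqnorm \<Omega> (\<lambda>x. f x + g x) \<le> 2 * L2_sqnorm \<Omega> f + 2 * L2_sqnorm \<Omega> g"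
proof -
  note i = assms[THEN L2_integrable_square] and m = assms[THEN L2_measurable]
  have i2: "integrable (lebesgue_on \<Omega>) (\<lambda>x. 2 * (cmod (f x))\<^sup>2 + 2 * (cmod (g x))\<^sup>2)"
    using i by simp
  have i3: "integrable (lebesgue_on \<Omega>) (\<lambda>x. (cmod (f x + g x))\<^sup>2)"
    using m by (intro Bochner_Integration.integrable_bound[OF i2])
      (auto simp: norm_add_square_le)
  show "(\<lambda>x. f x + g x) \<in> L2 \<Omega>" using i3 m by (simp add: L2_def)
  have "L2_sqnorm \<Omega> (\<lambda>x. f x + g x)
      \<le> (LINT x|lebesgue_on \<Omega>. 2 * (cmod (f x))\<^sup>2 + 2 * (cmod (g x))\<^sup>2)"
    unfolding L2_sqnorm_def by (rule integral_mono[OF i3 i2 norm_add_square_le])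
  also have "\<dots> = 2 * L2_sqnorm \<Omega> f + 2 * L2_sqnorm \<Omega> g"
    unfolding L2_sqnorm_def using i by simp
  finally show "L2_sqnorm \<Omega> (\<lambda>x. f x + g x) \<le> 2 * L2_sqnorm \<Omega> f + 2 * L2_sqnorm \<Omega> g" .
qed

lemma L2_uminus: "f \<in> L2 \<Omega> \<Longrightarrow> (\<lambda>x. - f x) \<in> L2 \<Omega>"
  using L2_cmult[of f \<Omega> "-1"] by simp

lemma L2_diff:
  assumes "f \<in> L2 \<Omega>" "g \<in> L2 \<Omega>"
  shows "(\<lambda>x. f x - g x) \<in> L2 \<Omega>"
    and "L2_sqnorm \<Omega> (\<lambda>x. f x - g x) \<le> 2 * L2_sqnorm \<Omega> f + 2 * L2_sqnorm \<Omega> g"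
  using L2_add[OF assms(1) L2_uminus[OF assms(2)]] by (simp_all add: L2_sqnorm_def)

lemma L2_sum:
  assumes "\<And>k. k \<in> F \<Longrightarrow> f k \<in> L2 \<Omega>"
  shows "(\<lambda>x. \<Sum>k\<in>F. f k x) \<in> L2 \<Omega>"
  using assms by (induction F rule: infinite_finite_induct) (auto intro: L2_add)

lemma L2_sqnorm_cong_AE:
  assumes "f \<in> L2 \<Omega>" "g \<in> L2 \<Omega>" "AE x in lebesgue_on \<Omega>. g x = f x"
  shows "L2_sqnorm \<Omega> g = L2_sqnorm \<Omega> f"
proof -
  have "AE x in lebesgue_on \<Omega>. (cmod (g x))\<^sup>2 = (cmod (f x))\<^sup>2"
    using assms(3) by eventually_elim simp
  with assms(1,2)[THEN L2_integrable_square] show ?thesis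
    unfolding L2_sqnorm_def by (intro integral_cong_AE) auto
qed

lemma L2_sqnorm_eq_0:
  assumes "f \<in> L2 \<Omega>" "L2_sqnorm \<Omega> f = 0"
  shows "AE x in lebesgue_on \<Omega>. f x = 0"
  using integral_nonneg_eq_0_iff_AE[OF L2_integrable_square[OF assms(1)]] assms(2)
  by (simp add: L2_sqnorm_def)

lemma L2_integrable_mult:
  assumes "f \<in> L2 \<Omega>" "g \<in> L2 \<Omega>"
  shows "integrable (lebesgue_on \<Omega>) (\<lambda>x. f x * cnj (g x))"
proof (rule Bochner_Integration.integrable_bound)
  show "integrable (lebesgue_on \<Omega>) (\<lambda>x. (cmod (f x))\<^sup>2 + (cmod (g x))\<^sup>2)"
    using assms[THEN L2_integrable_square] by simp
  show "(\<lambda>x. f x * cnj (g x)) \<in> borel_measurable (lebesgue_on \<Omega>)"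
    by (intro borel_measurable_times L2_measurable assms
        measurable_compose[OF L2_measurable[OF assms(2)] borel_measurable_continuous_onI])
      (intro continuous_intros)
  have "cmod (a * cnj b) \<le> norm ((cmod a)\<^sup>2 + (cmod b)\<^sup>2)" for a b
  proof -
    have "0 \<le> cmod a * cmod b" by simp
    moreover have "2 * (cmod a * cmod b) \<le> (cmod a)\<^sup>2 + (cmod b)\<^sup>2"
      using sum_squares_bound[of "cmod a" "cmod b"] by (simp only: mult.assoc)
    ultimately have "cmod a * cmod b \<le> (cmod a)\<^sup>2 + (cmod b)\<^sup>2" by linarith
    then show ?thesis by (simp add: norm_mult)
  qed
  then show "AE x in lebesgue_on \<Omega>. cmod (f x * cnj (g x)) \<le> norm ((cmod (f x))\<^sup>2 + (cmod (g x))\<^sup>2)"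
    by simp
qed

lemma L2_inner_commute: "L2_inner \<Omega> \<gamma> g f = cnj (L2_inner \<Omega> \<gamma> f g)"
  by (simp add: L2_inner_def mult.commute flip: Bochner_Integration.integral_cnj)

text \<open>
  Integrability of both products is required: the Bochner integral of a function that is not integrable
  is \<open>0\<close>, so additivity would fail in general.
\<close>

lemma L2_inner_add_left:
  assumes "f \<in> L2 \<Omega>" "g \<in> L2 \<Omega>" "h \<in> L2 \<Omega>"
  shows "L2_inner \<Omega> \<gamma> (\<lambda>x. f x + g x) h = L2_inner \<Omega> \<gamma> f h + L2_inner \<Omega> \<gamma> g h"
  using L2_integrable_mult[OF assms(1,3)] L2_integrable_mult[OF assms(2,3)]
  by (simp add: L2_inner_def algebra_simps)

lemma L2_inner_cmult_left: "L2_inner \<Omega> \<gamma> (\<lambda>x. c * f x) h = c * L2_inner \<Omega> \<gamma> f h"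
  by (simp add: L2_inner_def mult.assoc mult.left_commute[of "of_real (1 / \<gamma>)" c])

lemma L2_inner_sum_left:
  assumes "\<And>k. k \<in> F \<Longrightarrow> f k \<in> L2 \<Omega>" "h \<in> L2 \<Omega>"
  shows "L2_inner \<Omega> \<gamma> (\<lambda>x. \<Sum>k\<in>F. f k x) h = (\<Sum>k\<in>F. L2_inner \<Omega> \<gamma> (f k) h)"
  using assms
proof (induction F rule: infinite_finite_induct)
  case (insert a F)
  then have "(\<lambda>x. \<Sum>k\<in>F. f k x) \<in> L2 \<Omega>" by (intro L2_sum) auto
  with insert show ?case by (simp add: L2_inner_add_left)
qed (simp_all add: L2_inner_def)

lemma L2_sqnorm_dominated_convergence:
  assumes f: "f \<in> L2 \<Omega>" and g: "\<And>n. g n \<in> borel_measurable (lebesgue_on \<Omega>)"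
    and h: "h \<in> L2 \<Omega>"
    and bound: "\<And>n. AE x in lebesgue_on \<Omega>. cmod (g n x) \<le> cmod (h x)"
    and lim: "AE x in lebesgue_on \<Omega>. (\<lambda>n. g n x) \<longlonglongrightarrow> f x"
  shows "(\<lambda>n. L2_sqnorm \<Omega> (\<lambda>x. g n x - f x)) \<longlonglongrightarrow> 0"
proof -
  let ?w = "\<lambda>x. 2 * (cmod (h x))\<^sup>2 + 2 * (cmod (f x))\<^sup>2"
  have "(\<lambda>n. LINT x|lebesgue_on \<Omega>. (cmod (g n x - f x))\<^sup>2) \<longlonglongrightarrow> (LINT x|lebesgue_on \<Omega>. 0)"
  proof (rule integral_dominated_convergence)
    show "integrable (lebesgue_on \<Omega>) ?w"
      using f h by (simp add: L2_integrable_square)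
    show "(\<lambda>x. (cmod (g n x - f x))\<^sup>2) \<in> borel_measurable (lebesgue_on \<Omega>)" for n
      using g[of n] L2_measurable[OF f] by measurable
    show "AE x in lebesgue_on \<Omega>. (\<lambda>n. (cmod (g n x - f x))\<^sup>2) \<longlonglongrightarrow> 0"
      using lim
    proof eventually_elim
      case (elim x)
      then have "(\<lambda>n. (cmod (g n x - f x))\<^sup>2) \<longlonglongrightarrow> (cmod (f x - f x))\<^sup>2"
        by (intro tendsto_intros)
      then show ?case by simp
    qed
    show "AE x in lebesgue_on \<Omega>. norm ((cmod (g n x - f x))\<^sup>2) \<le> ?w x" for n
      using bound[of n]
    proof eventually_elim
      case (elim x)
      have "(cmod (g n x - f x))\<^sup>2 \<le> 2 * (cmod (g n x))\<^sup>2 + 2 * (cmod (f x))\<^sup>2"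
        using norm_add_square_le[of "g n x" "- f x"] by simp
      moreover have "(cmod (g n x))\<^sup>2 \<le> (cmod (h x))\<^sup>2"
        using elim by (intro power_mono) auto
      ultimately have "(cmod (g n x - f x))\<^sup>2 \<le> ?w x" by linarith
      then show ?case by simp
    qed
  qed simp
  then show ?thesis by (simp add: L2_sqnorm_def)
qed

section \<open>Unconditionally convergent series\<close>

text \<open>
  A constant positive weight changes norms only by a constant factor and hence has no influence on
  convergence.
\<close>

lemma L2_has_sum_iff:
  assumes "0 < \<gamma>"
  shows "L2_has_sum \<Omega> \<gamma> f s K \<longleftrightarrow> (\<forall>k\<in>K. f k \<in> L2 \<Omega>) \<and> s \<in> L2 \<Omega> \<and>
    ((\<lambda>F. L2_sqnorm \<Omega> (\<lambda>x. (\<Sum>k\<in>F. f k x) - s x)) \<longlongrightarrow> 0) (finite_subsets_at_top K)"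
proof -
  have "((\<lambda>F. sqrt (N F / \<gamma>)) \<longlongrightarrow> 0) G \<longleftrightarrow> (N \<longlongrightarrow> 0) G"
    if "\<And>F. 0 \<le> N F" for N :: "'b set \<Rightarrow> real" and G
  proof
    assume "((\<lambda>F. sqrt (N F / \<gamma>)) \<longlongrightarrow> 0) G"
    from tendsto_mult[OF tendsto_const[of \<gamma>] tendsto_power[OF this, of 2]]
    show "(N \<longlongrightarrow> 0) G" using assms that by simp
  next
    assume "(N \<longlongrightarrow> 0) G"
    from tendsto_real_sqrt[OF tendsto_divide[OF this tendsto_const[of \<gamma>]]]
    show "((\<lambda>F. sqrt (N F / \<gamma>)) \<longlongrightarrow> 0) G" using assms by simp
  qed
  from this[of "\<lambda>F. L2_sqnorm \<Omega> (\<lambda>x. (\<Sum>k\<in>F. f k x) - s x)"] show ?thesis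
    unfolding L2_has_sum_def L2_norm_eq by (simp add: L2_sqnorm_nonneg)
qed

lemma L2_has_sumI:
  assumes "0 < \<gamma>" "\<And>k. k \<in> K \<Longrightarrow> f k \<in> L2 \<Omega>" "s \<in> L2 \<Omega>"
    "(N \<longlongrightarrow> 0) (finite_subsets_at_top K)"
    "\<And>F. finite F \<Longrightarrow> F \<subseteq> K \<Longrightarrow> L2_sqnorm \<Omega> (\<lambda>x. (\<Sum>k\<in>F. f k x) - s x) \<le> N F"
  shows "L2_has_sum \<Omega> \<gamma> f s K"
  unfolding L2_has_sum_iff[OF assms(1)]
  using assms(2,3)
  by (auto intro!: tendsto_sandwich[OF _ _ tendsto_const assms(4)]
      simp: assms(5) L2_sqnorm_nonneg eventually_finite_subsets_at_top_weakI)

lemma tendsto_zero_double_sum: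
  fixes M N :: "'b \<Rightarrow> real"
  assumes "(M \<longlongrightarrow> 0) G" "(N \<longlongrightarrow> 0) G"
  shows "((\<lambda>x. 2 * M x + 2 * N x) \<longlongrightarrow> 0) G"
  using tendsto_add[OF tendsto_mult[OF tendsto_const[of 2] assms(1)]
    tendsto_mult[OF tendsto_const[of 2] assms(2)]] by simp

lemma L2_has_sum_unique:
  assumes "0 < \<gamma>" "L2_has_sum \<Omega> \<gamma> f s K" "L2_has_sum \<Omega> \<gamma> f t K"
  shows "AE x in lebesgue_on \<Omega>. s x = t x"
proof -
  note s = assms(2)[unfolded L2_has_sum_iff[OF assms(1)]]
    and t = assms(3)[unfolded L2_has_sum_iff[OF assms(1)]]
  let ?N = "\<lambda>s F. L2_sqnorm \<Omega> (\<lambda>x. (\<Sum>k\<in>F. f k x) - s x)"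
  have "L2_sqnorm \<Omega> (\<lambda>x. t x - s x) \<le> 0"
  proof (rule tendsto_le[OF finite_subsets_at_top_neq_bot _ tendsto_const])
    show "((\<lambda>F. 2 * ?N s F + 2 * ?N t F) \<longlongrightarrow> 0) (finite_subsets_at_top K)"
      using s t by (intro tendsto_zero_double_sum) auto
    have "L2_sqnorm \<Omega> (\<lambda>x. t x - s x) \<le> 2 * ?N s F + 2 * ?N t F" if "F \<subseteq> K" for F
    proof -
      have F: "(\<lambda>x. \<Sum>k\<in>F. f k x) \<in> L2 \<Omega>" using s that by (intro L2_sum) auto
      show ?thesis
        using L2_diff(2)[OF L2_diff(1)[OF F] L2_diff(1)[OF F], of s t] s t by simp
    qed
    then show "\<forall>\<^sub>F F in finite_subsets_at_top K. L2_sqnorm \<Omega> (\<lambda>x. t x - s x) \<le> 2 * ?N s F + 2 * ?N t F"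
      by (auto intro: eventually_finite_subsets_at_top_weakI)
  qed
  with L2_sqnorm_nonneg have "L2_sqnorm \<Omega> (\<lambda>x. t x - s x) = 0" by (metis order_antisym)
  from L2_sqnorm_eq_0[OF L2_diff(1) this] s t show ?thesis by auto
qed

text \<open>
  The sum of a convergent series is defined by a choice among representatives, and by uniqueness of limits
  the choice does not matter almost everywhere.
\<close>

lemma L2_infsum_unique:
  assumes "0 < \<gamma>" "L2_has_sum \<Omega> \<gamma> f s K"
  shows "AE x in lebesgue_on \<Omega>. L2_infsum \<Omega> \<gamma> f K x = s x"
  unfolding L2_infsum_def
  using L2_has_sum_unique[OF assms(1) someI[of "\<lambda>s. L2_has_sum \<Omega> \<gamma> f s K", OF assms(2)] assms(2)] .

lemma L2_has_sum_weight:
  assumes "0 < \<gamma>" "0 < \<delta>" "L2_has_sum \<Omega> \<gamma> f s K"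
  shows "L2_has_sum \<Omega> \<delta> f s K"
  using assms(3) unfolding L2_has_sum_iff[OF assms(1)] L2_has_sum_iff[OF assms(2)] .

lemma L2_has_sum_cong:
  assumes "0 < \<gamma>" "L2_has_sum \<Omega> \<gamma> f s K" "\<And>k. k \<in> K \<Longrightarrow> g k \<in> L2 \<Omega>" "t \<in> L2 \<Omega>"
    "\<And>k. k \<in> K \<Longrightarrow> AE x in lebesgue_on \<Omega>. g k x = f k x"
    "AE x in lebesgue_on \<Omega>. t x = s x"
  shows "L2_has_sum \<Omega> \<gamma> g t K"
proof (rule L2_has_sumI[OF assms(1,3,4)])
  note s = assms(2)[unfolded L2_has_sum_iff[OF assms(1)]]
  show "((\<lambda>F. L2_sqnorm \<Omega> (\<lambda>x. (\<Sum>k\<in>F. f k x) - s x)) \<longlongrightarrow> 0) (finite_subsets_at_top K)"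
    using s by blast
  fix F assume F: "finite F" "F \<subseteq> K"
  have "AE x in lebesgue_on \<Omega>. \<forall>k\<in>F. g k x = f k x"
    using F assms(5) by (intro AE_finite_allI) auto
  with assms(6) have "AE x in lebesgue_on \<Omega>. (\<Sum>k\<in>F. g k x) - t x = (\<Sum>k\<in>F. f k x) - s x"
    by eventually_elim simp
  then show "L2_sqnorm \<Omega> (\<lambda>x. (\<Sum>k\<in>F. g k x) - t x) \<le> L2_sqnorm \<Omega> (\<lambda>x. (\<Sum>k\<in>F. f k x) - s x)"
    using s F assms(3,4) by (intro eq_refl L2_sqnorm_cong_AE L2_diff L2_sum) auto
qed auto

lemma L2_has_sum_mult:
  assumes "0 < \<gamma>" "L2_has_sum \<Omega> \<gamma> f s K" "m \<in> borel_measurable (lebesgue_on \<Omega>)"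
    "AE x in lebesgue_on \<Omega>. cmod (m x) \<le> B"
  shows "L2_has_sum \<Omega> \<gamma> (\<lambda>k x. m x * f k x) (\<lambda>x. m x * s x) K"
proof (rule L2_has_sumI[OF assms(1)])
  note s = assms(2)[unfolded L2_has_sum_iff[OF assms(1)]]
  have mult: "(\<lambda>x. m x * h x) \<in> L2 \<Omega>" "L2_sqnorm \<Omega> (\<lambda>x. m x * h x) \<le> B\<^sup>2 * L2_sqnorm \<Omega> h"
    if "h \<in> L2 \<Omega>" for h
  proof -
    have "AE x in lebesgue_on \<Omega>. cmod (m x * h x) \<le> B * cmod (h x)"
      using assms(4) by eventually_elim (simp add: norm_mult mult_right_mono)
    moreover have "(\<lambda>x. m x * h x) \<in> borel_measurable (lebesgue_on \<Omega>)"
      using assms(3) L2_measurable[OF that] by measurable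
    ultimately show "(\<lambda>x. m x * h x) \<in> L2 \<Omega>"
        "L2_sqnorm \<Omega> (\<lambda>x. m x * h x) \<le> B\<^sup>2 * L2_sqnorm \<Omega> h"
      using L2_dominated that by blast+
  qed
  show "(\<lambda>x. m x * f k x) \<in> L2 \<Omega>" if "k \<in> K" for k using mult s that by blast
  show "(\<lambda>x. m x * s x) \<in> L2 \<Omega>" using mult s by blast
  show "((\<lambda>F. B\<^sup>2 * L2_sqnorm \<Omega> (\<lambda>x. (\<Sum>k\<in>F. f k x) - s x)) \<longlongrightarrow> 0) (finite_subsets_at_top K)"
    using tendsto_mult[OF tendsto_const[of "B\<^sup>2"]] s by fastforce
  fix F assume F: "finite F" "F \<subseteq> K"
  have "(\<lambda>x. (\<Sum>k\<in>F. m x * f k x) - m x * s x) = (\<lambda>x. m x * ((\<Sum>k\<in>F. f k x) - s x))"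
    by (simp add: sum_distrib_left algebra_simps)
  then show "L2_sqnorm \<Omega> (\<lambda>x. (\<Sum>k\<in>F. m x * f k x) - m x * s x)
      \<le> B\<^sup>2 * L2_sqnorm \<Omega> (\<lambda>x. (\<Sum>k\<in>F. f k x) - s x)"
    using s F by (simp only:) (intro mult(2) L2_diff(1) L2_sum; auto)
qed

lemma L2_has_sum_sum:
  assumes "0 < \<gamma>" "finite G" "\<And>g. g \<in> G \<Longrightarrow> L2_has_sum \<Omega> \<gamma> (f g) (s g) K"
  shows "L2_has_sum \<Omega> \<gamma> (\<lambda>k x. \<Sum>g\<in>G. f g k x) (\<lambda>x. \<Sum>g\<in>G. s g x) K"
  using assms(2,3)
proof (induction G rule: finite_induct)
  case empty
  show ?case
    by (rule L2_has_sumI[OF assms(1), where N = "\<lambda>_. 0"]) (auto simp: L2_sqnorm_def)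
next
  case (insert a G)
  have IH: "L2_has_sum \<Omega> \<gamma> (\<lambda>k x. \<Sum>g\<in>G. f g k x) (\<lambda>x. \<Sum>g\<in>G. s g x) K"
    using insert by simp
  have a: "L2_has_sum \<Omega> \<gamma> (f a) (s a) K" using insert.prems by simp
  note IH' = IH[unfolded L2_has_sum_iff[OF assms(1)]] and a' = a[unfolded L2_has_sum_iff[OF assms(1)]]
  let ?N1 = "\<lambda>F. L2_sqnorm \<Omega> (\<lambda>x. (\<Sum>k\<in>F. f a k x) - s a x)"
    and ?N2 = "\<lambda>F. L2_sqnorm \<Omega> (\<lambda>x. (\<Sum>k\<in>F. \<Sum>g\<in>G. f g k x) - (\<Sum>g\<in>G. s g x))"
  show ?case
  proof (rule L2_has_sumI[OF assms(1)])
    show "(\<lambda>x. \<Sum>g\<in>insert a G. f g k x) \<in> L2 \<Omega>" if "k \<in> K" for k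
      using insert IH' a' that by (simp add: L2_add)
    show "(\<lambda>x. \<Sum>g\<in>insert a G. s g x) \<in> L2 \<Omega>"
      using insert IH' a' by (simp add: L2_add)
    show "((\<lambda>F. 2 * ?N1 F + 2 * ?N2 F) \<longlongrightarrow> 0) (finite_subsets_at_top K)"
      using IH' a' by (intro tendsto_zero_double_sum) blast+
    fix F assume F: "finite F" "F \<subseteq> K"
    have "(\<lambda>x. (\<Sum>k\<in>F. \<Sum>g\<in>insert a G. f g k x) - (\<Sum>g\<in>insert a G. s g x))
        = (\<lambda>x. ((\<Sum>k\<in>F. f a k x) - s a x) + ((\<Sum>k\<in>F. \<Sum>g\<in>G. f g k x) - (\<Sum>g\<in>G. s g x)))"
      using insert.hyps by (simp add: sum.distrib algebra_simps)
    moreover have "(\<lambda>x. (\<Sum>k\<in>F. f a k x) - s a x) \<in> L2 \<Omega>"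
      using a' F by (intro L2_diff(1) L2_sum) blast+
    moreover have "(\<lambda>x. (\<Sum>k\<in>F. \<Sum>g\<in>G. f g k x) - (\<Sum>g\<in>G. s g x)) \<in> L2 \<Omega>"
      using IH' F by (intro L2_diff(1) L2_sum[of F "\<lambda>k x. \<Sum>g\<in>G. f g k x"]) blast+
    ultimately show "L2_sqnorm \<Omega> (\<lambda>x. (\<Sum>k\<in>F. \<Sum>g\<in>insert a G. f g k x) - (\<Sum>g\<in>insert a G. s g x))
        \<le> 2 * ?N1 F + 2 * ?N2 F"
      by (simp only: L2_add(2))
  qed
qed

text \<open>
  If an index set is a disjoint union of finitely many copies of \<open>J\<close> and the series converges along
  each copy, then it converges unconditionally along the union. This splits the series over the triples
  \<open>(j, k, g)\<close>, which defines the frame operator, into one series over \<open>(j, k)\<close> for each guide star.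
\<close>

lemma L2_has_sum_fibres:
  assumes "0 < \<gamma>" "finite G" "\<And>g. g \<in> G \<Longrightarrow> L2_has_sum \<Omega> \<gamma> (\<lambda>j. f (h g j)) (s g) J"
    "inj_on (\<lambda>(g, j). h g j) (G \<times> J)"
  shows "L2_has_sum \<Omega> \<gamma> f (\<lambda>x. \<Sum>g\<in>G. s g x) (\<Union>g\<in>G. h g ` J)"
  using assms(2-4)
proof (induction G rule: finite_induct)
  case empty
  then show ?case
    by (auto intro!: L2_has_sumI[OF assms(1), where N = "\<lambda>_. 0"] simp: L2_sqnorm_def)
next
  case (insert a G)
  let ?K = "\<Union>g\<in>G. h g ` J" and ?K' = "\<Union>g\<in>insert a G. h g ` J"
  let ?s = "\<lambda>x. \<Sum>g\<in>G. s g x"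
  have IH: "L2_has_sum \<Omega> \<gamma> f ?s ?K"
  proof (rule insert.IH)
    show "inj_on (\<lambda>(g, j). h g j) (G \<times> J)"
      by (rule inj_on_subset[OF insert.prems(2)]) auto
  qed (use insert.prems in auto)
  note IH' = IH[unfolded L2_has_sum_iff[OF assms(1)]]
  have a: "L2_has_sum \<Omega> \<gamma> (\<lambda>j. f (h a j)) (s a) J" using insert.prems by simp
  note a' = a[unfolded L2_has_sum_iff[OF assms(1)]]
  have inj: "inj_on (h a) J" using insert.prems(2) by (auto simp: inj_on_def)
  have disj: "h a ` J \<inter> ?K = {}" using insert.prems(2) insert.hyps(2) by (fastforce simp: inj_on_def)
  let ?N1 = "\<lambda>F. L2_sqnorm \<Omega> (\<lambda>x. (\<Sum>j\<in>F. f (h a j) x) - s a x)"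
    and ?N2 = "\<lambda>F. L2_sqnorm \<Omega> (\<lambda>x. (\<Sum>k\<in>F. f k x) - ?s x)"
  show ?case
  proof (rule L2_has_sumI[OF assms(1)])
    show "f k \<in> L2 \<Omega>" if "k \<in> ?K'" for k using that IH' a' by auto
    show "(\<lambda>x. \<Sum>g\<in>insert a G. s g x) \<in> L2 \<Omega>"
      using insert.prems(1)[unfolded L2_has_sum_iff[OF assms(1)]] by (intro L2_sum) blast
    \<comment> \<open>A large finite part of the union is large both within the new copy and within the others.\<close>
    have l1: "filterlim (\<lambda>F. {j\<in>J. h a j \<in> F}) (finite_subsets_at_top J) (finite_subsets_at_top ?K')"
      unfolding filterlim_finite_subsets_at_top eventually_finite_subsets_at_top
    proof (intro allI impI)
      fix X assume X: "finite X \<and> X \<subseteq> J"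
      have "finite {j \<in> J. h a j \<in> Y}" if "finite Y" for Y
        using finite_vimage_IntI[OF that inj] by (simp add: vimage_def Int_def conj_commute)
      with X show "\<exists>Xa. finite Xa \<and> Xa \<subseteq> ?K' \<and> (\<forall>Y. finite Y \<and> Xa \<subseteq> Y \<and> Y \<subseteq> ?K' \<longrightarrow>
          finite {j \<in> J. h a j \<in> Y} \<and> X \<subseteq> {j \<in> J. h a j \<in> Y} \<and> {j \<in> J. h a j \<in> Y} \<subseteq> J)"
        by (intro exI[of _ "h a ` X"]) auto
    qed
    have l2: "filterlim (\<lambda>F. F \<inter> ?K) (finite_subsets_at_top ?K) (finite_subsets_at_top ?K')"
      unfolding filterlim_finite_subsets_at_top eventually_finite_subsets_at_top
      by (intro allI impI, rule exI, erule conjE, intro conjI, assumption) auto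
    show "((\<lambda>F. 2 * ?N1 {j\<in>J. h a j \<in> F} + 2 * ?N2 (F \<inter> ?K)) \<longlongrightarrow> 0) (finite_subsets_at_top ?K')"
      using IH' a'
      by (intro tendsto_zero_double_sum filterlim_compose[OF _ l1, of ?N1]
          filterlim_compose[OF _ l2, of ?N2]) blast+
    fix F assume F: "finite F" "F \<subseteq> ?K'"
    have eq: "(\<Sum>k\<in>F. f k x) = (\<Sum>j\<in>{j\<in>J. h a j \<in> F}. f (h a j) x) + (\<Sum>k\<in>F \<inter> ?K. f k x)" for x
    proof -
      let ?A = "h a ` {j\<in>J. h a j \<in> F}"
      have "F = ?A \<union> (F \<inter> ?K)" using F by auto
      then have "(\<Sum>k\<in>F. f k x) = (\<Sum>k\<in>?A \<union> (F \<inter> ?K). f k x)" by simp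
      also have "\<dots> = (\<Sum>k\<in>?A. f k x) + (\<Sum>k\<in>F \<inter> ?K. f k x)"
      proof (rule sum.union_disjoint)
        show "finite ?A" by (rule finite_subset[OF _ F(1)]) auto
        show "?A \<inter> (F \<inter> ?K) = {}" using disj by auto
      qed (use F in auto)
      also have "(\<Sum>k\<in>?A. f k x) = (\<Sum>j\<in>{j\<in>J. h a j \<in> F}. f (h a j) x)"
        using inj by (subst sum.reindex) (auto simp: inj_on_def)
      finally show ?thesis .
    qed
    have "(\<lambda>x. (\<Sum>k\<in>F. f k x) - (\<Sum>g\<in>insert a G. s g x))
        = (\<lambda>x. ((\<Sum>j\<in>{j\<in>J. h a j \<in> F}. f (h a j) x) - s a x) + ((\<Sum>k\<in>F \<inter> ?K. f k x) - ?s x))"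
      unfolding eq using insert.hyps by (simp add: algebra_simps)
    moreover have "(\<lambda>x. (\<Sum>j\<in>{j\<in>J. h a j \<in> F}. f (h a j) x) - s a x) \<in> L2 \<Omega>"
      using a' by (intro L2_diff(1) L2_sum) auto
    moreover have "(\<lambda>x. (\<Sum>k\<in>F \<inter> ?K. f k x) - ?s x) \<in> L2 \<Omega>"
      using IH' by (intro L2_diff(1) L2_sum[where f = f]) blast+
    ultimately show "L2_sqnorm \<Omega> (\<lambda>x. (\<Sum>k\<in>F. f k x) - (\<Sum>g\<in>insert a G. s g x))
        \<le> 2 * ?N1 {j\<in>J. h a j \<in> F} + 2 * ?N2 (F \<inter> ?K)"
      by (simp only: L2_add(2))
  qed
qed

section \<open>Change of domain\<close>

lemma borel_measurable_lebesgue_on_zero_extension: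
  fixes f :: "'a::euclidean_space \<Rightarrow> complex"
  assumes "U \<in> sets lebesgue" "f \<in> borel_measurable (lebesgue_on U)"
  shows "(\<lambda>x. indicator U x * f x) \<in> borel_measurable (lebesgue_on V)"
proof -
  have "(\<lambda>x. indicator U x *\<^sub>R f x) \<in> borel_measurable lebesgue"
    using assms by (simp add: borel_measurable_restrict_space_iff)
  also have "(\<lambda>x. indicator U x *\<^sub>R f x) = (\<lambda>x. indicator U x * f x)"
    by (auto simp: indicator_def)
  finally show ?thesis by (rule measurable_restrict_space1)
qed

lemma L2_zero_extension:
  assumes "U \<in> sets lebesgue" "V \<in> sets lebesgue" "U \<subseteq> V" "f \<in> L2 U"
  shows "(\<lambda>x. indicator U x * f x) \<in> L2 V"
    and "L2_sqnorm V (\<lambda>x. indicator U x * f x) = L2_sqnorm U f"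
proof -
  have eq: "indicator V x * (cmod (indicator U x * f x))\<^sup>2 = indicator U x * (cmod (f x))\<^sup>2" for x
    using assms(3) by (auto simp: indicator_def)
  show "(\<lambda>x. indicator U x * f x) \<in> L2 V"
    using assms borel_measurable_lebesgue_on_zero_extension[OF assms(1) L2_measurable[OF assms(4)]]
    unfolding L2_def by (auto simp: integrable_restrict_space eq)
  show "L2_sqnorm V (\<lambda>x. indicator U x * f x) = L2_sqnorm U f"
    unfolding L2_sqnorm_def using assms by (simp add: integral_restrict_space eq)
qed

lemma integral_zero_extension:
  fixes f h :: "'a::euclidean_space \<Rightarrow> complex"
  assumes "U \<in> sets lebesgue" "V \<in> sets lebesgue" "U \<subseteq> V"
    and f: "\<And>x. f x = c * (indicator U x * h x)"
  shows "(LINT x|lebesgue_on V. f x) = c * (LINT x|lebesgue_on U. h x)"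
proof -
  have "(LINT x|lebesgue_on V. f x) = (LINT x|lebesgue. indicator V x *\<^sub>R f x)"
    using assms(2) by (simp add: integral_restrict_space)
  also have "\<dots> = (LINT x|lebesgue. c * (indicator U x *\<^sub>R h x))"
    using assms(3) by (intro Bochner_Integration.integral_cong refl) (auto simp: f indicator_def)
  also have "\<dots> = c * (LINT x|lebesgue. indicator U x *\<^sub>R h x)"
    by (rule integral_mult_right_zero)
  also have "\<dots> = c * (LINT x|lebesgue_on U. h x)"
    using assms(1) by (simp add: integral_restrict_space)
  finally show ?thesis .
qed

lemma L2_restrict:
  assumes "U \<in> sets lebesgue" "V \<in> sets lebesgue" "U \<subseteq> V" "f \<in> L2 V"
  shows "f \<in> L2 U"
proof -
  have m: "f \<in> borel_measurable (lebesgue_on U)"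
    using L2_measurable[OF assms(4)] assms measurable_restrict_mono by blast
  have eq: "indicator U x * (indicator V x * (cmod (f x))\<^sup>2) = indicator U x * (cmod (f x))\<^sup>2" for x
    using assms(3) by (auto simp: indicator_def)
  have "integrable lebesgue (\<lambda>x. indicator V x *\<^sub>R (cmod (f x))\<^sup>2)"
    using L2_integrable_square[OF assms(4)] assms(2) by (simp add: integrable_restrict_space)
  from integrable_mult_indicator[OF assms(1) this]
  have "integrable (lebesgue_on U) (\<lambda>x. (cmod (f x))\<^sup>2)"
    using assms(1) by (simp add: integrable_restrict_space eq)
  with m show ?thesis by (simp add: L2_def)
qed

lemma L2_has_sum_zero_extension:
  assumes "0 < \<gamma>" "U \<in> sets lebesgue" "V \<in> sets lebesgue" "U \<subseteq> V" "L2_has_sum U \<gamma> f s K"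
  shows "L2_has_sum V \<gamma> (\<lambda>k x. indicator U x * f k x) (\<lambda>x. indicator U x * s x) K"
proof (rule L2_has_sumI[OF assms(1)])
  note s = assms(5)[unfolded L2_has_sum_iff[OF assms(1)]]
  show "(\<lambda>x. indicator U x * f k x) \<in> L2 V" if "k \<in> K" for k
    using that s assms by (intro L2_zero_extension(1)) auto
  show "(\<lambda>x. indicator U x * s x) \<in> L2 V" using s assms by (intro L2_zero_extension(1)) auto
  show "((\<lambda>F. L2_sqnorm U (\<lambda>x. (\<Sum>k\<in>F. f k x) - s x)) \<longlongrightarrow> 0) (finite_subsets_at_top K)"
    using s by blast
  fix F assume F: "finite F" "F \<subseteq> K"
  have "(\<lambda>x. (\<Sum>k\<in>F. f k x) - s x) \<in> L2 U" using s F by (intro L2_diff(1) L2_sum) auto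
  from L2_zero_extension(2)[OF assms(2-4) this]
  show "L2_sqnorm V (\<lambda>x. (\<Sum>k\<in>F. indicator U x * f k x) - indicator U x * s x)
      \<le> L2_sqnorm U (\<lambda>x. (\<Sum>k\<in>F. f k x) - s x)"
    by (simp add: sum_distrib_left algebra_simps)
qed

lemma L2_has_sum_restrict:
  assumes "0 < \<gamma>" "U \<in> sets lebesgue" "V \<in> sets lebesgue" "U \<subseteq> V" "L2_has_sum V \<gamma> f s K"
  shows "L2_has_sum U \<gamma> f s K"
proof (rule L2_has_sumI[OF assms(1)])
  note s = assms(5)[unfolded L2_has_sum_iff[OF assms(1)]]
  show "f k \<in> L2 U" if "k \<in> K" for k using s that L2_restrict[OF assms(2-4)] by blast
  show "s \<in> L2 U" using s L2_restrict[OF assms(2-4)] by blast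
  show "((\<lambda>F. L2_sqnorm V (\<lambda>x. (\<Sum>k\<in>F. f k x) - s x)) \<longlongrightarrow> 0) (finite_subsets_at_top K)"
    using s by blast
  fix F assume F: "finite F" "F \<subseteq> K"
  let ?d = "\<lambda>x. (\<Sum>k\<in>F. f k x) - s x"
  have d: "?d \<in> L2 V" using s F by (intro L2_diff(1) L2_sum[where f = f]) blast+
  have "L2_sqnorm U ?d = L2_sqnorm V (\<lambda>x. indicator U x * ?d x)"
    using L2_zero_extension(2)[OF assms(2-4) L2_restrict[OF assms(2-4) d]] by simp
  also have "\<dots> \<le> 1\<^sup>2 * L2_sqnorm V ?d"
    using d assms(2)
    by (intro L2_dominated(2) borel_measurable_lebesgue_on_zero_extension L2_measurable
        L2_restrict[OF assms(2-4)]) (auto simp: indicator_def)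
  finally show "L2_sqnorm U ?d \<le> L2_sqnorm V ?d" by simp
qed

text \<open>
  The substitution \<open>x = (r - a) / c\<close>, from the transformation of the Lebesgue measure under affine maps.
\<close>

lemma lebesgue_on_affine:
  fixes a :: "'a::euclidean_space" and c :: real and \<Omega> :: "'a set"
  assumes "0 < c" and \<Omega>: "\<Omega> \<in> sets lebesgue"
  defines "T \<equiv> \<lambda>r. (r - a) /\<^sub>R c"
  shows sets_affine_vimage: "T -` \<Omega> \<in> sets lebesgue"
    and measurable_affine: "T \<in> lebesgue_on (T -` \<Omega>) \<rightarrow>\<^sub>M lebesgue_on \<Omega>"
    and integral_affine: "\<And>h :: 'a \<Rightarrow> 'b::{banach, second_countable_topology}.
      h \<in> borel_measurable (lebesgue_on \<Omega>) \<Longrightarrow>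
      (LINT r|lebesgue_on (T -` \<Omega>). h (T r)) = c ^ DIM('a) *\<^sub>R (LINT x|lebesgue_on \<Omega>. h x)"
    and integrable_affine: "\<And>h :: 'a \<Rightarrow> 'b::{banach, second_countable_topology}.
      integrable (lebesgue_on \<Omega>) h \<Longrightarrow> integrable (lebesgue_on (T -` \<Omega>)) (\<lambda>r. h (T r))"
proof -
  have T: "T = (\<lambda>x. (- a /\<^sub>R c) + (\<Sum>j\<in>Basis. ((1 / c) * (x \<bullet> j)) *\<^sub>R j))"
  proof
    fix x :: 'a
    have "(\<Sum>j\<in>Basis. ((1 / c) * (x \<bullet> j)) *\<^sub>R j) = (1 / c) *\<^sub>R (\<Sum>j\<in>Basis. (x \<bullet> j) *\<^sub>R j)"
      by (simp add: scaleR_sum_right)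
    then show "T x = (- a /\<^sub>R c) + (\<Sum>j\<in>Basis. ((1 / c) * (x \<bullet> j)) *\<^sub>R j)"
      unfolding T_def by (simp add: euclidean_representation algebra_simps divide_inverse_commute)
  qed
  have Tm [measurable]: "T \<in> lebesgue \<rightarrow>\<^sub>M lebesgue"
    unfolding T by (rule lebesgue_affine_measurable) (use assms(1) in auto)
  have D: "lebesgue = density (distr lebesgue lebesgue T) (\<lambda>_. ennreal ((1 / c) ^ DIM('a)))"
    using lebesgue_affine_euclidean[of "\<lambda>_. 1 / c" "- a /\<^sub>R c"] assms(1)
    unfolding T[symmetric] by simp
  show v: "T -` \<Omega> \<in> sets lebesgue"
    using measurable_sets[OF Tm \<Omega>] by simp
  show "T \<in> lebesgue_on (T -` \<Omega>) \<rightarrow>\<^sub>M lebesgue_on \<Omega>"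
    by (rule measurable_restrict_space3[OF Tm]) auto
  have ind: "indicator (T -` \<Omega>) r *\<^sub>R h (T r) = indicator \<Omega> (T r) *\<^sub>R h (T r)" for r and h :: "'a \<Rightarrow> 'b"
    by (simp add: indicator_def)
  {
    fix h :: "'a \<Rightarrow> 'b"
    assume "h \<in> borel_measurable (lebesgue_on \<Omega>)"
    then have m: "(\<lambda>x. indicator \<Omega> x *\<^sub>R h x) \<in> borel_measurable lebesgue"
      using \<Omega> by (simp add: borel_measurable_restrict_space_iff)
    have "(LINT x|lebesgue_on \<Omega>. h x) = (LINT x|lebesgue. indicator \<Omega> x *\<^sub>R h x)"
      using \<Omega> by (simp add: integral_restrict_space)
    also have "\<dots> = (LINT r|lebesgue. (1 / c) ^ DIM('a) *\<^sub>R (indicator \<Omega> (T r) *\<^sub>R h (T r)))"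
    proof -
      have m': "(\<lambda>x. indicator \<Omega> x *\<^sub>R h x) \<in> borel_measurable (distr lebesgue lebesgue T)"
        using m by simp
      show ?thesis
        unfolding integral_distr[OF Tm m] integral_scaleR_right
        by (subst D) (use assms(1) in \<open>simp add: integral_density[OF m'] integral_distr[OF Tm m] del: scaleR_scaleR\<close>)
    qed
    also have "\<dots> = (1 / c) ^ DIM('a) *\<^sub>R (LINT r|lebesgue_on (T -` \<Omega>). h (T r))"
      using v by (simp add: integral_restrict_space ind del: scaleR_scaleR)
    finally show "(LINT r|lebesgue_on (T -` \<Omega>). h (T r)) = c ^ DIM('a) *\<^sub>R (LINT x|lebesgue_on \<Omega>. h x)"
      using assms(1) by (simp add: power_divide)
  }
  {
    fix h :: "'a \<Rightarrow> 'b"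
    assume h: "integrable (lebesgue_on \<Omega>) h"
    have i: "integrable lebesgue (\<lambda>x. indicator \<Omega> x *\<^sub>R h x)"
      using h \<Omega> by (simp add: integrable_restrict_space)
    have m: "(\<lambda>x. indicator \<Omega> x *\<^sub>R h x) \<in> borel_measurable lebesgue"
      by (rule borel_measurable_integrable[OF i])
    have m': "(\<lambda>x. indicator \<Omega> x *\<^sub>R h x) \<in> borel_measurable (distr lebesgue lebesgue T)"
      using m by simp
    have "integrable (distr lebesgue lebesgue T) (\<lambda>x. (1 / c) ^ DIM('a) *\<^sub>R (indicator \<Omega> x *\<^sub>R h x))"
      using i assms(1) by (subst (asm) D) (simp add: integrable_density[OF m'] del: scaleR_scaleR)
    from integrable_scaleR_right[OF this, of "c ^ DIM('a)"]
    have "integrable (distr lebesgue lebesgue T) (\<lambda>x. indicator \<Omega> x *\<^sub>R h x)"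
      using assms(1) by (simp add: power_divide)
    from integrable_distr[OF Tm this]
    have "integrable lebesgue (\<lambda>r. indicator \<Omega> (T r) *\<^sub>R h (T r))" .
    then show "integrable (lebesgue_on (T -` \<Omega>)) (\<lambda>r. h (T r))"
      using v by (simp add: integrable_restrict_space ind)
  }
qed

lemma L2_affine:
  fixes a :: "'a::euclidean_space"
  assumes "0 < c" "\<Omega> \<in> sets lebesgue" "f \<in> L2 \<Omega>"
  shows "(\<lambda>r. f ((r - a) /\<^sub>R c)) \<in> L2 ((\<lambda>r. (r - a) /\<^sub>R c) -` \<Omega>)"
    and "L2_sqnorm ((\<lambda>r. (r - a) /\<^sub>R c) -` \<Omega>) (\<lambda>r. f ((r - a) /\<^sub>R c)) = c ^ DIM('a) * L2_sqnorm \<Omega> f"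
proof -
  have "(\<lambda>r. f ((r - a) /\<^sub>R c)) \<in> borel_measurable (lebesgue_on ((\<lambda>r. (r - a) /\<^sub>R c) -` \<Omega>))"
    by (rule measurable_compose[OF measurable_affine L2_measurable]) fact+
  then show "(\<lambda>r. f ((r - a) /\<^sub>R c)) \<in> L2 ((\<lambda>r. (r - a) /\<^sub>R c) -` \<Omega>)"
    using integrable_affine[OF assms(1,2) L2_integrable_square[OF assms(3)], of a]
    by (simp add: L2_def)
  have "(\<lambda>x. (cmod (f x))\<^sup>2) \<in> borel_measurable (lebesgue_on \<Omega>)"
    using L2_measurable[OF assms(3)] by measurable
  from integral_affine[OF assms(1,2) this, of a]
  show "L2_sqnorm ((\<lambda>r. (r - a) /\<^sub>R c) -` \<Omega>) (\<lambda>r. f ((r - a) /\<^sub>R c)) = c ^ DIM('a) * L2_sqnorm \<Omega> f"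
    by (simp add: L2_sqnorm_def)
qed

lemma L2_has_sum_affine:
  fixes a :: "'a::euclidean_space"
  assumes "0 < \<gamma>" "0 < c" "\<Omega> \<in> sets lebesgue" "L2_has_sum \<Omega> \<gamma> f s K"
  shows "L2_has_sum ((\<lambda>r. (r - a) /\<^sub>R c) -` \<Omega>) \<gamma>
    (\<lambda>k r. f k ((r - a) /\<^sub>R c)) (\<lambda>r. s ((r - a) /\<^sub>R c)) K"
proof (rule L2_has_sumI[OF assms(1)])
  note s = assms(4)[unfolded L2_has_sum_iff[OF assms(1)]]
  let ?V = "(\<lambda>r. (r - a) /\<^sub>R c) -` \<Omega>"
  show "(\<lambda>r. f k ((r - a) /\<^sub>R c)) \<in> L2 ?V" if "k \<in> K" for k
    using that s by (intro L2_affine(1) assms) blast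
  show "(\<lambda>r. s ((r - a) /\<^sub>R c)) \<in> L2 ?V" using s by (intro L2_affine(1) assms) blast
  show "((\<lambda>F. c ^ DIM('a) * L2_sqnorm \<Omega> (\<lambda>x. (\<Sum>k\<in>F. f k x) - s x)) \<longlongrightarrow> 0) (finite_subsets_at_top K)"
    using s by (intro tendsto_mult_right_zero) blast
  fix F assume F: "finite F" "F \<subseteq> K"
  have "(\<lambda>x. (\<Sum>k\<in>F. f k x) - s x) \<in> L2 \<Omega>"
    using s F by (intro L2_diff(1) L2_sum[where f = f]) blast+
  from L2_affine(2)[OF assms(2,3) this, of a]
  show "L2_sqnorm ?V (\<lambda>r. (\<Sum>k\<in>F. f k ((r - a) /\<^sub>R c)) - s ((r - a) /\<^sub>R c))
      \<le> c ^ DIM('a) * L2_sqnorm \<Omega> (\<lambda>x. (\<Sum>k\<in>F. f k x) - s x)" by (rule eq_refl)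
qed

section \<open>Orthonormal expansions\<close>

text \<open>
  Completing the square in each coefficient: the error of a linear combination of orthonormal functions
  is smallest when the coefficients are the Fourier coefficients.
\<close>

lemma L2_sqnorm_diff_orthonormal_sum:
  assumes "f \<in> L2 \<Omega>" "finite F" "\<And>k. k \<in> F \<Longrightarrow> e k \<in> L2 \<Omega>"
    and orth: "\<And>j k. j \<in> F \<Longrightarrow> k \<in> F \<Longrightarrow> L2_inner \<Omega> 1 (e j) (e k) = (if j = k then 1 else 0)"
  shows "L2_sqnorm \<Omega> (\<lambda>x. (\<Sum>k\<in>F. b k * e k x) - f x)
    = L2_sqnorm \<Omega> f - (\<Sum>k\<in>F. (cmod (L2_inner \<Omega> 1 f (e k)))\<^sup>2)
      + (\<Sum>k\<in>F. (cmod (b k - L2_inner \<Omega> 1 f (e k)))\<^sup>2)"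
proof -
  let ?I = "L2_inner \<Omega> 1" and ?c = "\<lambda>k. L2_inner \<Omega> 1 f (e k)"
  define p where "p = (\<lambda>x. \<Sum>k\<in>F. b k * e k x)"
  have p: "p \<in> L2 \<Omega>" unfolding p_def using assms(3) by (intro L2_sum L2_cmult)
  have f': "(\<lambda>x. - f x) \<in> L2 \<Omega>" using assms(1) by (rule L2_uminus)
  have d: "(\<lambda>x. p x + - f x) \<in> L2 \<Omega>" by (rule L2_add(1)[OF p f'])
  have left: "?I (\<lambda>x. p x + - f x) g = ?I p g - ?I f g" if "g \<in> L2 \<Omega>" for g
    using L2_inner_add_left[OF p f' that] L2_inner_cmult_left[of \<Omega> 1 "-1" f g] by simp
  have pg: "?I p g = (\<Sum>k\<in>F. b k * ?I (e k) g)" if "g \<in> L2 \<Omega>" for g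
    unfolding p_def using assms(3) that
    by (subst L2_inner_sum_left) (auto simp: L2_inner_cmult_left intro: L2_cmult)
  have pe: "?I p (e k) = b k" if "k \<in> F" for k
    using assms(2,3) that by (simp add: pg orth if_distrib cong: if_cong sum.cong)
  have pf: "?I p f = (\<Sum>k\<in>F. b k * cnj (?c k))"
    unfolding pg[OF assms(1)] using L2_inner_commute[of \<Omega> 1 "e _" f] by simp
  have pp: "?I p p = (\<Sum>k\<in>F. b k * cnj (b k))"
    unfolding pg[OF p] using L2_inner_commute[of \<Omega> 1 "e _" p] by (simp add: pe)
  have "?I (\<lambda>x. p x + - f x) (\<lambda>x. p x + - f x)
      = ?I p (\<lambda>x. p x + - f x) - ?I f (\<lambda>x. p x + - f x)" by (rule left[OF d])
  also have "?I p (\<lambda>x. p x + - f x) = ?I p p - cnj (?I f p)"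
    using left[OF p] L2_inner_commute[of \<Omega> 1 p "\<lambda>x. p x + - f x"] L2_inner_commute[of \<Omega> 1 p p]
    by simp
  also have "cnj (?I f p) = ?I p f" by (metis L2_inner_commute)
  also have "?I f (\<lambda>x. p x + - f x) = cnj (?I p f) - ?I f f"
    using left[OF assms(1)] L2_inner_commute[of \<Omega> 1 f "\<lambda>x. p x + - f x"] L2_inner_commute[of \<Omega> 1 f f]
    by simp
  finally have "?I (\<lambda>x. p x + - f x) (\<lambda>x. p x + - f x)
      = (\<Sum>k\<in>F. b k * cnj (b k) - b k * cnj (?c k) - cnj (b k) * ?c k) + ?I f f"
    by (simp add: pf pp sum_subtractf)
  also have "(\<Sum>k\<in>F. b k * cnj (b k) - b k * cnj (?c k) - cnj (b k) * ?c k)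
      = (\<Sum>k\<in>F. (b k - ?c k) * cnj (b k - ?c k) - ?c k * cnj (?c k))"
    by (intro sum.cong refl) (simp add: algebra_simps)
  also have "\<dots> = of_real ((\<Sum>k\<in>F. (cmod (b k - ?c k))\<^sup>2) - (\<Sum>k\<in>F. (cmod (?c k))\<^sup>2))"
    by (simp only: complex_norm_square[symmetric] sum_subtractf of_real_diff of_real_sum)
  finally have "of_real (L2_sqnorm \<Omega> (\<lambda>x. p x + - f x)) =
      (of_real (L2_sqnorm \<Omega> f - (\<Sum>k\<in>F. (cmod (?c k))\<^sup>2) + (\<Sum>k\<in>F. (cmod (b k - ?c k))\<^sup>2)) :: complex)"
    by (simp add: L2_inner_self)
  then show ?thesis unfolding p_def of_real_eq_iff by simp
qed

text \<open>
  If some linear combination over \<open>F\<close> is within \<open>\<epsilon>\<close> of \<open>f\<close>, then so is the Fourier sum over every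
  finite \<open>H \<supseteq> F\<close>: it is the best approximation over \<open>F\<close>, and each further term reduces the error
  by the square of its coefficient. So density of the linear combinations gives unconditional convergence.
\<close>

lemma L2_has_sum_orthonormal_basis:
  assumes "f \<in> L2 \<Omega>" "\<And>k. k \<in> K \<Longrightarrow> e k \<in> L2 \<Omega>"
    and orth: "\<And>j k. j \<in> K \<Longrightarrow> k \<in> K \<Longrightarrow> L2_inner \<Omega> 1 (e j) (e k) = (if j = k then 1 else 0)"
    and dense: "\<And>\<epsilon>. 0 < \<epsilon> \<Longrightarrow> \<exists>F b. finite F \<and> F \<subseteq> K \<and>
      L2_sqnorm \<Omega> (\<lambda>x. (\<Sum>k\<in>F. b k * e k x) - f x) < \<epsilon>"
  shows "L2_has_sum \<Omega> 1 (\<lambda>k x. L2_inner \<Omega> 1 f (e k) * e k x) f K"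
  unfolding L2_has_sum_iff[OF zero_less_one]
proof (intro conjI ballI)
  let ?c = "\<lambda>k. L2_inner \<Omega> 1 f (e k)"
  show "(\<lambda>x. ?c k * e k x) \<in> L2 \<Omega>" if "k \<in> K" for k using assms(2) that by (intro L2_cmult)
  show "f \<in> L2 \<Omega>" by fact
  show "((\<lambda>F. L2_sqnorm \<Omega> (\<lambda>x. (\<Sum>k\<in>F. ?c k * e k x) - f x)) \<longlongrightarrow> 0) (finite_subsets_at_top K)"
  proof (rule tendstoI)
    fix \<epsilon> :: real assume "0 < \<epsilon>"
    from dense[OF this] obtain F b where F: "finite F" "F \<subseteq> K"
      and b: "L2_sqnorm \<Omega> (\<lambda>x. (\<Sum>k\<in>F. b k * e k x) - f x) < \<epsilon>" by blast
    have "L2_sqnorm \<Omega> (\<lambda>x. (\<Sum>k\<in>H. ?c k * e k x) - f x) < \<epsilon>"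
      if H: "finite H" "F \<subseteq> H" "H \<subseteq> K" for H
    proof -
      have eq: "L2_sqnorm \<Omega> (\<lambda>x. (\<Sum>k\<in>X. a k * e k x) - f x)
          = L2_sqnorm \<Omega> f - (\<Sum>k\<in>X. (cmod (?c k))\<^sup>2) + (\<Sum>k\<in>X. (cmod (a k - ?c k))\<^sup>2)"
        if "finite X" "X \<subseteq> K" for X a
        using that by (intro L2_sqnorm_diff_orthonormal_sum assms(1) assms(2) orth) auto
      have "(\<Sum>k\<in>F. (cmod (?c k))\<^sup>2) \<le> (\<Sum>k\<in>H. (cmod (?c k))\<^sup>2)"
        using H by (intro sum_mono2) auto
      moreover have "0 \<le> (\<Sum>k\<in>F. (cmod (b k - ?c k))\<^sup>2)" by (intro sum_nonneg) auto
      ultimately have "L2_sqnorm \<Omega> (\<lambda>x. (\<Sum>k\<in>H. ?c k * e k x) - f x)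
          \<le> L2_sqnorm \<Omega> (\<lambda>x. (\<Sum>k\<in>F. b k * e k x) - f x)"
        using eq[OF H(1,3), of ?c] eq[OF F, of b] by simp
      with b show ?thesis by simp
    qed
    with F show "\<forall>\<^sub>F H in finite_subsets_at_top K.
        dist (L2_sqnorm \<Omega> (\<lambda>x. (\<Sum>k\<in>H. ?c k * e k x) - f x)) 0 < \<epsilon>"
      unfolding eventually_finite_subsets_at_top by (auto simp: L2_sqnorm_nonneg)
  qed
qed

section \<open>Waves on the square\<close>

lemma wave_eq: "wave P j k r = of_real (1 / (2 * halfwidth P)) *
    exp (\<i> * of_real (pi / halfwidth P * (of_int j * fst r + of_int k * snd r)))"
  by (cases r) (simp add: wave_def)

lemma wave_mult:
  "wave P j k r * wave P j' k' r = of_real (1 / (2 * halfwidth P)) * wave P (j + j') (k + k') r"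
  unfolding wave_eq by (simp add: algebra_simps add_divide_distrib flip: exp_add)

text \<open>
  The waves are characters up to normalisation. This identity is the reason for the factor \<open>2 T\<close> and the
  phases \<open>w\<^sub>j\<^sub>k(-a/c)\<close> in the definition of the reconstruction operator.
\<close>

lemma wave_shift:
  assumes "0 < halfwidth P"
  shows "of_real (2 * halfwidth P) * wave P j k (- a) * wave P j k r = wave P j k (r - a)"
proof -
  have "\<i> * of_real (pi / halfwidth P * (of_int j * fst (r - a) + of_int k * snd (r - a)))
      = \<i> * of_real (pi / halfwidth P * (of_int j * fst (- a) + of_int k * snd (- a)))
        + \<i> * of_real (pi / halfwidth P * (of_int j * fst r + of_int k * snd r))"
    by (simp add: algebra_simps)
  then show ?thesis
    using assms unfolding wave_eq by (simp only: exp_add) simp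
qed

lemma square_eq_cbox: "square P = cbox (- halfwidth P, - halfwidth P) (halfwidth P, halfwidth P)"
  by (auto simp: square_def)

lemma square_measurable [simp]: "square P \<in> sets lebesgue"
  by (simp add: square_eq_cbox)

lemma continuous_on_wave: "continuous_on A (wave P j k)"
  unfolding wave_eq by (intro continuous_intros)

lemma continuous_L2_square:
  assumes "continuous_on UNIV f"
  shows "f \<in> L2 (square P)"
proof -
  have c: "continuous_on (square P) f" using assms continuous_on_subset by blast
  have "continuous_on (square P) (\<lambda>x. (cmod (f x))\<^sup>2)"
    by (intro continuous_intros c)
  then have "integrable (lebesgue_on (square P)) (\<lambda>x. (cmod (f x))\<^sup>2)"
    unfolding square_eq_cbox by (rule continuous_imp_integrable)
  with continuous_imp_measurable_on_sets_lebesgue[OF c] show ?thesis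
    by (simp add: L2_def)
qed

lemma wave_L2_square: "wave P j k \<in> L2 (square P)"
  by (rule continuous_L2_square[OF continuous_on_wave])

lemma integral_exp_period:
  assumes "0 < T"
  shows "integral {-T..T} (\<lambda>x. exp (\<i> * of_real (pi / T * (of_int m * x)))) = (if m = 0 then of_real (2 * T) else 0)"
proof (cases "m = 0")
  case True
  then show ?thesis using assms by (simp add: scaleR_conv_of_real)
next
  case False
  \<comment> \<open>The antiderivative \<open>exp (c x) / c\<close> has period \<open>2 T\<close>, so the integral over a period is zero.\<close>
  define c where "c = \<i> * of_real (pi / T * of_int m)"
  have c0: "c \<noteq> 0" using False assms by (simp add: c_def)
  have "((\<lambda>x. exp (c * of_real x)) has_integral exp (c * of_real T) / c - exp (c * of_real (-T)) / c) {-T..T}"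
  proof (rule fundamental_theorem_of_calculus)
    fix x
    have "((\<lambda>z. exp (c * z) / c) has_field_derivative exp (c * of_real x)) (at (of_real x))"
      using c0 by (auto intro!: derivative_eq_intros)
    from has_vector_derivative_real_field[OF this]
    show "((\<lambda>x. exp (c * of_real x) / c) has_vector_derivative exp (c * of_real x)) (at x within {-T..T})"
      by (rule has_vector_derivative_at_within)
  qed (use assms in simp)
  moreover have "exp (c * of_real T) = exp (c * of_real (-T))"
  proof -
    have "c * of_real T = c * of_real (-T) + of_int (2 * m) * (of_real pi * \<i>)"
      using assms by (simp add: c_def)
    then show ?thesis by (auto simp: exp_eq)
  qed
  moreover have "exp (\<i> * of_real (pi / T * (of_int m * x))) = exp (c * of_real x)" for x
    by (simp add: c_def mult_ac)
  ultimately show ?thesis using False by (simp add: integral_unique)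
qed

lemma wave_orthonormal:
  assumes "0 < halfwidth P"
  shows "L2_inner (square P) 1 (wave P j k) (wave P j' k') = (if j = j' \<and> k = k' then 1 else 0)"
proof -
  let ?T = "halfwidth P"
  let ?E = "\<lambda>m x. exp (\<i> * of_real (pi / ?T * (of_int m * x))) :: complex"
  have prod: "wave P j k r * cnj (wave P j' k' r)
      = of_real ((1 / (2 * ?T))\<^sup>2) * (?E (j - j') (fst r) * ?E (k - k') (snd r))" for r
    unfolding wave_eq
    by (simp add: exp_cnj power2_eq_square algebra_simps diff_divide_distrib add_divide_distrib flip: exp_add)
  have cont: "continuous_on A (\<lambda>r. ?E (j - j') (fst r) * ?E (k - k') (snd r))" for A
    by (intro continuous_intros)
  have "L2_inner (square P) 1 (wave P j k) (wave P j' k')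
      = of_real ((1 / (2 * ?T))\<^sup>2) * (LINT r|lebesgue_on (square P). ?E (j - j') (fst r) * ?E (k - k') (snd r))"
    unfolding L2_inner_def prod by simp
  also have "(LINT r|lebesgue_on (square P). ?E (j - j') (fst r) * ?E (k - k') (snd r))
      = integral (square P) (\<lambda>r. ?E (j - j') (fst r) * ?E (k - k') (snd r))"
    using cont unfolding square_eq_cbox
    by (intro lebesgue_integral_eq_integral continuous_imp_integrable) auto
  also have "\<dots> = integral {-?T..?T} (\<lambda>x. integral {-?T..?T} (\<lambda>y. ?E (j - j') x * ?E (k - k') y))"
    unfolding square_eq_cbox using integral_prod_continuous[OF cont] by simp
  also have "\<dots> = integral {-?T..?T} (?E (j - j')) * integral {-?T..?T} (?E (k - k'))"
    by (simp only: integral_mult_right integral_mult_left)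
  also have "\<dots> = (if j - j' = 0 then of_real (2 * ?T) else 0) * (if k - k' = 0 then of_real (2 * ?T) else 0)"
    unfolding integral_exp_period[OF assms] ..
  finally show ?thesis using assms by (auto simp: power2_eq_square)
qed

section \<open>Density of the trigonometric polynomials\<close>

text \<open>
  The linear span of the waves. The inductive form makes closure under multiplication, needed for
  polynomials on the torus, a plain rule induction.
\<close>

inductive trig_poly :: "tomography \<Rightarrow> (real \<times> real \<Rightarrow> complex) \<Rightarrow> bool" for P where
  wave: "trig_poly P (\<lambda>r. c * wave P j k r)"
| add: "trig_poly P p \<Longrightarrow> trig_poly P q \<Longrightarrow> trig_poly P (\<lambda>r. p r + q r)"

lemma trig_poly_mult:
  assumes "trig_poly P p" "trig_poly P q"
  shows "trig_poly P (\<lambda>r. p r * q r)"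
  using assms
proof (induction arbitrary: q rule: trig_poly.induct)
  case (wave c j k)
  from wave.prems show ?case
  proof (induction rule: trig_poly.induct)
    case (wave d j' k')
    have "(\<lambda>r. c * wave P j k r * (d * wave P j' k' r))
        = (\<lambda>r. (c * d * of_real (1 / (2 * halfwidth P))) * wave P (j + j') (k + k') r)"
      using wave_mult[of P j k _ j' k'] by (auto simp: fun_eq_iff mult_ac)
    then show ?case by (simp only: trig_poly.wave)
  next
    case (add p q)
    from trig_poly.add[OF add.IH] show ?case by (simp add: algebra_simps)
  qed
next
  case (add p1 p2)
  from trig_poly.add[OF add.IH[OF add.prems]] show ?case by (simp add: algebra_simps)
qed

lemma trig_poly_const:
  assumes "0 < halfwidth P"
  shows "trig_poly P (\<lambda>r. c)"
  using trig_poly.wave[of P "c * of_real (2 * halfwidth P)" 0 0] assms by (simp add: wave_eq)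

lemma trig_poly_cmult:
  assumes "0 < halfwidth P" "trig_poly P p"
  shows "trig_poly P (\<lambda>r. c * p r)"
  using trig_poly_mult[OF trig_poly_const[OF assms(1)] assms(2)] .

lemma trig_poly_continuous: "trig_poly P t \<Longrightarrow> continuous_on A t"
  by (induction rule: trig_poly.induct) (auto intro!: continuous_intros continuous_on_wave)

lemma trig_poly_expansion:
  assumes "trig_poly P p"
  shows "\<exists>F b. finite F \<and> p = (\<lambda>r. \<Sum>i\<in>F. b i * wave P (fst i) (snd i) r)"
  using assms
proof induction
  case (wave c j k)
  show ?case by (intro exI[of _ "{(j, k)}"] exI[of _ "\<lambda>_. c"]) simp
next
  case (add p q)
  then obtain F b G c where F: "finite F" "p = (\<lambda>r. \<Sum>i\<in>F. b i * wave P (fst i) (snd i) r)"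
    and G: "finite G" "q = (\<lambda>r. \<Sum>i\<in>G. c i * wave P (fst i) (snd i) r)" by blast
  let ?w = "\<lambda>i. wave P (fst i) (snd i)"
  have ext: "(\<Sum>i\<in>H. (if i \<in> A then a i else 0) * ?w i r) = (\<Sum>i\<in>A. a i * ?w i r)"
    if "finite H" "A \<subseteq> H" for H A a r
    using that by (intro sum.mono_neutral_cong_right) auto
  show ?case
    by (intro exI[of _ "F \<union> G"] exI[of _ "\<lambda>i. (if i \<in> F then b i else 0) + (if i \<in> G then c i else 0)"])
      (simp add: F G ext distrib_right sum.distrib fun_eq_iff)
qed

text \<open>
  Wraps the square onto the torus of pairs of unimodular numbers. Opposite edges are identified, so that
  continuous functions on the torus correspond to continuous functions with periods \<open>2 T\<close>.
\<close>

definition torus_map :: "tomography \<Rightarrow> real \<times> real \<Rightarrow> complex \<times> complex" where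
  "torus_map P r = (cis (pi / halfwidth P * fst r), cis (pi / halfwidth P * snd r))"

lemma trig_poly_cos_sin:
  assumes "0 < halfwidth P"
  shows "trig_poly P (\<lambda>r. of_real (cos (pi / halfwidth P * fst r)))"
    and "trig_poly P (\<lambda>r. of_real (sin (pi / halfwidth P * fst r)))"
    and "trig_poly P (\<lambda>r. of_real (cos (pi / halfwidth P * snd r)))"
    and "trig_poly P (\<lambda>r. of_real (sin (pi / halfwidth P * snd r)))"
proof -
  let ?T = "of_real (halfwidth P) :: complex"
  have c: "of_real (cos t) = (exp (\<i> * of_real t) + exp (\<i> * of_real (- t))) / 2"
    and s: "of_real (sin t) = (exp (\<i> * of_real t) - exp (\<i> * of_real (- t))) / (2 * \<i>)" for t
    by (simp_all add: cos_of_real sin_of_real cos_exp_eq sin_exp_eq flip: cos_of_real sin_of_real)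
  have T: "?T \<noteq> 0" using assms by simp
  have "of_real (cos (pi / halfwidth P * fst r)) = ?T * wave P 1 0 r + ?T * wave P (-1) 0 r"
    "of_real (sin (pi / halfwidth P * fst r)) = (- \<i> * ?T) * wave P 1 0 r + (\<i> * ?T) * wave P (-1) 0 r"
    "of_real (cos (pi / halfwidth P * snd r)) = ?T * wave P 0 1 r + ?T * wave P 0 (-1) r"
    "of_real (sin (pi / halfwidth P * snd r)) = (- \<i> * ?T) * wave P 0 1 r + (\<i> * ?T) * wave P 0 (-1) r" for r
    unfolding c s wave_eq using T by (simp_all add: field_simps)
  then show "trig_poly P (\<lambda>r. of_real (cos (pi / halfwidth P * fst r)))"
    "trig_poly P (\<lambda>r. of_real (sin (pi / halfwidth P * fst r)))"
    "trig_poly P (\<lambda>r. of_real (cos (pi / halfwidth P * snd r)))"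
    "trig_poly P (\<lambda>r. of_real (sin (pi / halfwidth P * snd r)))"
    by (simp_all only: trig_poly.intros)
qed

text \<open>
  Polynomials on the torus pull back to trigonometric polynomials, since the four real coordinates pull
  back to sines and cosines and trigonometric polynomials form an algebra.
\<close>

lemma trig_poly_real_polynomial:
  fixes p :: "complex \<times> complex \<Rightarrow> real"
  assumes "0 < halfwidth P" "real_polynomial_function p"
  shows "trig_poly P (\<lambda>r. of_real (p (torus_map P r)))"
  using assms(2)
proof induction
  case (linear f)
  interpret bounded_linear f by fact
  have f: "f (z, w) = Re z * f (1, 0) + Im z * f (\<i>, 0) + Re w * f (0, 1) + Im w * f (0, \<i>)" for z w
  proof -
    have "(z, w) = Re z *\<^sub>R (1, 0) + Im z *\<^sub>R (\<i>, 0) + Re w *\<^sub>R (0, 1) + Im w *\<^sub>R (0, \<i>)"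
      by (simp add: complex_eq_iff)
    then show ?thesis by (simp only: add scaleR real_scaleR_def)
  qed
  have "(\<lambda>r. of_real (f (torus_map P r)) :: complex) =
      (\<lambda>r. of_real (f (1, 0)) * of_real (cos (pi / halfwidth P * fst r))
         + of_real (f (\<i>, 0)) * of_real (sin (pi / halfwidth P * fst r))
         + of_real (f (0, 1)) * of_real (cos (pi / halfwidth P * snd r))
         + of_real (f (0, \<i>)) * of_real (sin (pi / halfwidth P * snd r)))"
  proof
    fix r
    show "(of_real (f (torus_map P r)) :: complex) =
        of_real (f (1, 0)) * of_real (cos (pi / halfwidth P * fst r))
         + of_real (f (\<i>, 0)) * of_real (sin (pi / halfwidth P * fst r))
         + of_real (f (0, 1)) * of_real (cos (pi / halfwidth P * snd r))
         + of_real (f (0, \<i>)) * of_real (sin (pi / halfwidth P * snd r))"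
      unfolding torus_map_def
      by (subst f) (simp only: cis.sel of_real_add of_real_mult mult.commute)
  qed
  then show ?case
    using assms(1) by (simp only:) (intro trig_poly.add trig_poly_cmult trig_poly_cos_sin)
next
  case (const c)
  show ?case using trig_poly_const[OF assms(1)] .
next
  case (add f g)
  then show ?case by (simp add: trig_poly.add)
next
  case (mult f g)
  then show ?case by (simp add: trig_poly_mult)
qed

lemma trig_poly_polynomial:
  fixes p :: "complex \<times> complex \<Rightarrow> complex"
  assumes "0 < halfwidth P" "polynomial_function p"
  shows "trig_poly P (\<lambda>r. p (torus_map P r))"
proof -
  have "real_polynomial_function (Re \<circ> p)" "real_polynomial_function (Im \<circ> p)"
    using assms(2) bounded_linear_Re bounded_linear_Im unfolding polynomial_function_def by blast+
  from this[THEN trig_poly_real_polynomial[OF assms(1)]]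
  have "trig_poly P (\<lambda>r. of_real (Re (p (torus_map P r))) + \<i> * of_real (Im (p (torus_map P r))))"
    using assms(1) by (intro trig_poly.add trig_poly_cmult) simp_all
  then show ?thesis by (simp flip: complex_eq)
qed

lemma trig_poly_uniform_approx:
  fixes G :: "complex \<times> complex \<Rightarrow> complex"
  assumes "0 < halfwidth P" "continuous_on (sphere 0 1 \<times> sphere 0 1) G" "0 < \<epsilon>"
  shows "\<exists>t. trig_poly P t \<and> (\<forall>r. cmod (t r - G (torus_map P r)) < \<epsilon>)"
proof -
  have "compact (sphere 0 1 \<times> sphere 0 1 :: (complex \<times> complex) set)"
    by (intro compact_Times compact_sphere)
  from Stone_Weierstrass_polynomial_function[OF this assms(2,3)] obtain p where
    p: "polynomial_function p" "\<And>x. x \<in> sphere 0 1 \<times> sphere 0 1 \<Longrightarrow> cmod (G x - p x) < \<epsilon>" by blast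
  have "cmod (p (torus_map P r) - G (torus_map P r)) < \<epsilon>" for r
    using p(2)[of "torus_map P r"] by (simp add: torus_map_def norm_minus_commute)
  with trig_poly_polynomial[OF assms(1) p(1)] show ?thesis by blast
qed

definition trig_approximable :: "tomography \<Rightarrow> (real \<times> real \<Rightarrow> complex) \<Rightarrow> bool" where
  "trig_approximable P f \<longleftrightarrow> f \<in> L2 (square P) \<and>
     (\<forall>\<epsilon>>0. \<exists>t. trig_poly P t \<and> L2_sqnorm (square P) (\<lambda>r. t r - f r) < \<epsilon>)"

lemma trig_approximable_continuous:
  assumes "0 < halfwidth P" "continuous_on (sphere 0 1 \<times> sphere 0 1) G"
  shows "trig_approximable P (\<lambda>r. G (torus_map P r))"
  unfolding trig_approximable_def
proof (intro conjI allI impI)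
  have "continuous_on UNIV (torus_map P)"
    unfolding torus_map_def cis_conv_exp by (intro continuous_intros)
  then have "continuous_on UNIV (\<lambda>r. G (torus_map P r))"
    by (rule continuous_on_compose2[OF assms(2)]) (auto simp: torus_map_def)
  then show G: "(\<lambda>r. G (torus_map P r)) \<in> L2 (square P)" by (rule continuous_L2_square)
  fix \<epsilon> :: real assume "0 < \<epsilon>"
  define C where "C = L2_sqnorm (square P) (\<lambda>_. 1)"
  have C: "0 \<le> C" by (simp add: C_def L2_sqnorm_nonneg)
  define \<delta> where "\<delta> = sqrt (\<epsilon> / (C + 1))"
  have \<delta>: "0 < \<delta>" "\<delta>\<^sup>2 = \<epsilon> / (C + 1)" using \<open>0 < \<epsilon>\<close> C by (auto simp: \<delta>_def)
  from trig_poly_uniform_approx[OF assms \<delta>(1)] obtain t where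
    t: "trig_poly P t" "\<And>r. cmod (t r - G (torus_map P r)) < \<delta>" by blast
  have t2: "t \<in> L2 (square P)" by (rule continuous_L2_square[OF trig_poly_continuous[OF t(1)]])
  have "L2_sqnorm (square P) (\<lambda>r. t r - G (torus_map P r)) \<le> \<delta>\<^sup>2 * C"
    unfolding C_def using less_imp_le[OF t(2)]
    by (intro L2_dominated(2) L2_measurable L2_diff(1) t2 G continuous_L2_square) simp_all
  also have "\<dots> < \<epsilon>" unfolding \<delta> using \<open>0 < \<epsilon>\<close> C by (simp add: field_simps)
  finally show "\<exists>t. trig_poly P t \<and> L2_sqnorm (square P) (\<lambda>r. t r - G (torus_map P r)) < \<epsilon>"
    using t(1) by blast
qed

text \<open>
  Being approximable survives dominated limits. The proof of density uses this twice: for truncation of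
  a square-integrable function, and for passage from continuous to bounded measurable functions.
\<close>

lemma trig_approximable_limit:
  assumes f: "f \<in> L2 (square P)" and g: "\<And>n. trig_approximable P (g n)"
    and h: "h \<in> L2 (square P)"
    and bound: "\<And>n. AE x in lebesgue_on (square P). cmod (g n x) \<le> cmod (h x)"
    and lim: "AE x in lebesgue_on (square P). (\<lambda>n. g n x) \<longlonglongrightarrow> f x"
  shows "trig_approximable P f"
  unfolding trig_approximable_def
proof (intro conjI allI impI f)
  fix \<epsilon> :: real assume "0 < \<epsilon>"
  have g2: "g n \<in> L2 (square P)" for n using g unfolding trig_approximable_def by blast
  have "(\<lambda>n. L2_sqnorm (square P) (\<lambda>x. g n x - f x)) \<longlonglongrightarrow> 0"
    by (rule L2_sqnorm_dominated_convergence[OF f L2_measurable[OF g2] h bound lim])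
  then have "\<forall>\<^sub>F n in sequentially. L2_sqnorm (square P) (\<lambda>x. g n x - f x) < \<epsilon> / 4"
    by (rule order_tendstoD) (use \<open>0 < \<epsilon>\<close> in simp)
  then obtain n where n: "L2_sqnorm (square P) (\<lambda>x. g n x - f x) < \<epsilon> / 4"
    by (auto simp: eventually_sequentially)
  have "0 < \<epsilon> / 4" using \<open>0 < \<epsilon>\<close> by simp
  then obtain t where t: "trig_poly P t" "L2_sqnorm (square P) (\<lambda>r. t r - g n r) < \<epsilon> / 4"
    using g[of n] unfolding trig_approximable_def by blast
  have t2: "t \<in> L2 (square P)" by (rule continuous_L2_square[OF trig_poly_continuous[OF t(1)]])
  have "L2_sqnorm (square P) (\<lambda>r. (t r - g n r) + (g n r - f r)) \<le> 2 * (L2_sqnorm (square P) (\<lambda>r. t r - g n r))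
      + 2 * (L2_sqnorm (square P) (\<lambda>r. g n r - f r))"
    by (intro L2_add(2) L2_diff(1) t2 g2 f)
  also have "\<dots> < \<epsilon>" using n t(2) by simp
  finally show "\<exists>t. trig_poly P t \<and> L2_sqnorm (square P) (\<lambda>r. t r - f r) < \<epsilon>"
    using t(1) by auto
qed

text \<open>
  A bounded function that is continuous wherever the cutoff does not vanish becomes continuous after
  multiplication by the cutoff: at a zero of the cutoff the product is squeezed to \<open>0\<close>. Here it removes
  the jump of the argument function at \<open>-1\<close>.
\<close>

lemma continuous_on_cutoff:
  fixes \<eta> :: "'a::metric_space \<Rightarrow> real" and h :: "'a \<Rightarrow> complex"
  assumes "continuous_on S \<eta>" "\<And>x. x \<in> S \<Longrightarrow> cmod (h x) \<le> M"
    "\<And>x. x \<in> S \<Longrightarrow> \<eta> x \<noteq> 0 \<Longrightarrow> continuous (at x within S) h"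
  shows "continuous_on S (\<lambda>x. of_real (\<eta> x) * h x)"
  unfolding continuous_on_eq_continuous_within
proof
  fix x assume x: "x \<in> S"
  have \<eta>: "continuous (at x within S) \<eta>" using assms(1) x by (simp add: continuous_on_eq_continuous_within)
  show "continuous (at x within S) (\<lambda>x. of_real (\<eta> x) * h x)"
  proof (cases "\<eta> x = 0")
    case False
    then show ?thesis using assms(3)[OF x False] \<eta> by (intro continuous_intros)
  next
    case True
    have lim: "((\<lambda>y. \<bar>\<eta> y\<bar> * M) \<longlongrightarrow> \<bar>\<eta> x\<bar> * M) (at x within S)"
      using \<eta> unfolding continuous_within by (intro tendsto_intros)
    have "((\<lambda>y. of_real (\<eta> y) * h y) \<longlongrightarrow> 0) (at x within S)"
    proof (rule Lim_null_comparison)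
      show "((\<lambda>y. \<bar>\<eta> y\<bar> * M) \<longlongrightarrow> 0) (at x within S)" using lim True by simp
      show "\<forall>\<^sub>F y in at x within S. cmod (of_real (\<eta> y) * h y) \<le> \<bar>\<eta> y\<bar> * M"
        using assms(2) by (auto simp: eventually_at_filter norm_mult intro!: always_eventually mult_left_mono)
    qed
    then show ?thesis using True by (simp add: continuous_within)
  qed
qed

text \<open>
  Lebesgue measurability provides continuous functions \<open>g\<^sub>n\<close> on the plane that converge to \<open>f\<close> almost
  everywhere on the square. They need not be bounded or periodic. The projection \<open>\<kappa>\<close> onto the disc of radius
  \<open>M\<close> makes them bounded, and leaves \<open>f\<close> unchanged; the cutoffs \<open>\<eta>\<^sub>n\<close>, which vanish on the image of the
  boundary of the square and tend to \<open>1\<close> elsewhere, make them continuous functions \<open>G\<^sub>n\<close> on the torus.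
\<close>

lemma trig_approximable_bounded:
  assumes T: "0 < halfwidth P" and f: "f \<in> borel_measurable (lebesgue_on (square P))"
    and M: "\<And>x. cmod (f x) \<le> M"
  shows "trig_approximable P f"
proof -
  let ?T = "halfwidth P" and ?Q = "square P"
  have M0: "0 \<le> M" using M[of undefined] norm_ge_zero order_trans by blast
  have c2: "(\<lambda>_. of_real M) \<in> L2 ?Q" by (intro continuous_L2_square continuous_intros)
  have f2: "f \<in> L2 ?Q"
    by (rule L2_dominated(1)[OF f c2, where B = 1]) (use M M0 in auto)
  have "f measurable_on ?Q"
    using f by (simp add: measurable_on_iff_borel_measurable)
  then obtain N g where N: "negligible N" and g: "\<And>n. continuous_on UNIV (g n)"
    and lim: "\<And>x. x \<notin> N \<Longrightarrow> (\<lambda>n. g n x) \<longlonglongrightarrow> (if x \<in> ?Q then f x else 0)"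
    unfolding measurable_on_def by blast
  define \<kappa> where "\<kappa> = closest_point (cball (0::complex) M)"
  have \<kappa>: "continuous_on UNIV \<kappa>" "\<And>z. cmod (\<kappa> z) \<le> M" "\<And>z. cmod z \<le> M \<Longrightarrow> \<kappa> z = z"
    using M0 closest_point_in_set[of "cball (0::complex) M"]
    by (auto simp: \<kappa>_def closest_point_self intro!: continuous_on_closest_point)
  \<comment> \<open>A left inverse of the map onto the torus on the open square.\<close>
  define lift where "lift = (\<lambda>(z, w). (Arg z * ?T / pi, Arg w * ?T / pi))"
  define \<eta> where "\<eta> n = (\<lambda>(z, w). min 1 (real n * cmod (z + 1)) * min 1 (real n * cmod (w + 1)))" for n
  define G where "G n x = of_real (\<eta> n x) * \<kappa> (g n (lift x))" for n x
  have \<eta>: "0 \<le> \<eta> n x" "\<eta> n x \<le> 1" for n x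
    by (auto simp: \<eta>_def split: prod.split intro: mult_le_one)
  have G: "continuous_on (sphere 0 1 \<times> sphere 0 1) (G n)" for n
    unfolding G_def
  proof (rule continuous_on_cutoff[OF _ \<kappa>(2)])
    show "continuous_on (sphere 0 1 \<times> sphere 0 1) (\<eta> n)"
      unfolding \<eta>_def case_prod_beta by (intro continuous_intros)
    fix x :: "complex \<times> complex"
    assume x: "x \<in> sphere 0 1 \<times> sphere 0 1" "\<eta> n x \<noteq> 0"
    \<comment> \<open>On the unit circle the branch cut of the argument is the single point \<open>-1\<close>.\<close>
    have slit: "z \<notin> \<real>\<^sub>\<le>\<^sub>0" if "cmod z = 1" "z \<noteq> - 1" for z :: complex
    proof
      assume "z \<in> \<real>\<^sub>\<le>\<^sub>0"
      then have "z = - of_real (cmod z)" by (auto elim!: nonpos_Reals_cases)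
      with that show False by simp
    qed
    have "fst x \<noteq> - 1" "snd x \<noteq> - 1" "cmod (fst x) = 1" "cmod (snd x) = 1"
      using x by (auto simp: \<eta>_def)
    then have "fst x \<notin> \<real>\<^sub>\<le>\<^sub>0" "snd x \<notin> \<real>\<^sub>\<le>\<^sub>0"
      using slit by auto
    then have "isCont lift x"
      unfolding lift_def case_prod_beta
      by (intro continuous_intros isCont_o2[OF _ continuous_at_Arg, unfolded o_def]) auto
    moreover have "isCont (\<lambda>y. \<kappa> (g n y)) y" for y
      using continuous_on_compose2[OF \<kappa>(1) g[of n]]
      by (metis continuous_on_eq_continuous_at open_UNIV UNIV_I top_greatest)
    ultimately have "isCont (\<lambda>x. \<kappa> (g n (lift x))) x" by (rule isCont_o2)
    then show "continuous (at x within sphere 0 1 \<times> sphere 0 1) (\<lambda>x. \<kappa> (g n (lift x)))"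
      by (rule continuous_at_imp_continuous_within)
  qed
  have conv: "(\<lambda>n. G n (torus_map P r)) \<longlonglongrightarrow> f r"
    if r: "r \<in> box (- ?T, - ?T) (?T, ?T)" "r \<notin> N" for r
  proof -
    have r': "\<bar>fst r\<bar> < ?T" "\<bar>snd r\<bar> < ?T" "r \<in> ?Q"
      using r(1) by (cases r; auto simp: mem_box square_eq_cbox Basis_prod_def)+
    have ang: "Arg (cis (pi / ?T * x)) = pi / ?T * x" "cis (pi / ?T * x) \<noteq> -1" if "\<bar>x\<bar> < ?T" for x
    proof -
      have "\<bar>pi / ?T * x\<bar> < pi" using that T by (simp add: abs_mult field_simps)
      then have b: "- pi < pi / ?T * x" "pi / ?T * x < pi" by linarith+
      then show a: "Arg (cis (pi / ?T * x)) = pi / ?T * x" by (intro Arg_cis) auto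
      show "cis (pi / ?T * x) \<noteq> -1" using a b Arg_cis[of pi] by auto
    qed
    have lift: "lift (torus_map P r) = r"
      using r' ang T by (simp add: lift_def torus_map_def)
    have ev: "\<forall>\<^sub>F n in sequentially. min 1 (real n * cmod (z + 1)) = 1" if "z \<noteq> -1" for z :: complex
    proof -
      have "0 < cmod (z + 1)" using that by (simp add: eq_neg_iff_add_eq_0)
      then obtain m where m: "1 < real m * cmod (z + 1)" using reals_Archimedean3 by blast
      have "1 \<le> real n * cmod (z + 1)" if "m \<le> n" for n
        using m mult_right_mono[of "real m" "real n" "cmod (z + 1)"] that by simp
      then show ?thesis by (auto simp: eventually_sequentially min_def intro!: exI[of _ m] antisym)
    qed
    have "\<forall>\<^sub>F n in sequentially. \<kappa> (g n r) = G n (torus_map P r)"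
      using ev[OF ang(2)[OF r'(1)]] ev[OF ang(2)[OF r'(2)]]
      by eventually_elim (simp add: G_def lift, simp add: \<eta>_def torus_map_def)
    moreover have "(\<lambda>n. \<kappa> (g n r)) \<longlonglongrightarrow> \<kappa> (f r)"
      using lim[OF r(2)] r'(3) \<kappa>(1)
      by (intro isCont_tendsto_compose[where g = \<kappa>]) (auto simp: continuous_on_eq_continuous_at)
    ultimately show ?thesis using \<kappa>(3)[OF M] by (simp add: Lim_transform_eventually)
  qed
  show ?thesis
  proof (rule trig_approximable_limit[OF f2 trig_approximable_continuous[OF T G] c2])
    fix n
    have "cmod (G n x) \<le> 1 * M" for x
      unfolding G_def norm_mult using \<eta>[of n x] \<kappa>(2) by (intro mult_mono) auto
    then show "AE x in lebesgue_on ?Q. cmod (G n (torus_map P x)) \<le> cmod (of_real M)"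
      using M0 by simp
  next
    let ?N = "N \<union> (cbox (- ?T, - ?T) (?T, ?T) - box (- ?T, - ?T) (?T, ?T))"
    have "negligible ?N" using N negligible_frontier_interval negligible_Un by blast
    then have "?N \<in> null_sets lebesgue" by (simp add: negligible_iff_null_sets)
    then have "AE x in lebesgue. x \<in> ?Q \<longrightarrow> (\<lambda>n. G n (torus_map P x)) \<longlonglongrightarrow> f x"
      by (rule AE_I') (use conv in \<open>auto simp: square_eq_cbox\<close>)
    then show "AE x in lebesgue_on ?Q. (\<lambda>n. G n (torus_map P x)) \<longlonglongrightarrow> f x"
      by (simp add: AE_restrict_space_iff)
  qed
qed

lemma trig_approximable_L2:
  assumes T: "0 < halfwidth P" and f: "f \<in> L2 (square P)"
  shows "trig_approximable P f"
proof (rule trig_approximable_limit[OF f _ f])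
  let ?g = "\<lambda>n x. if cmod (f x) \<le> real n then f x else 0"
  show "trig_approximable P (?g n)" for n
  proof (rule trig_approximable_bounded[OF T])
    show "?g n \<in> borel_measurable (lebesgue_on (square P))"
      using L2_measurable[OF f] by measurable
  qed auto
  show "AE x in lebesgue_on (square P). cmod (?g n x) \<le> cmod (f x)" for n by simp
  have "(\<lambda>n. ?g n x) \<longlonglongrightarrow> f x" for x
  proof (rule tendsto_eventually)
    obtain m where m: "cmod (f x) \<le> real m" using real_arch_simple by blast
    then show "\<forall>\<^sub>F n in sequentially. ?g n x = f x"
      by (auto simp: eventually_sequentially intro!: exI[of _ m])
  qed
  then show "AE x in lebesgue_on (square P). (\<lambda>n. ?g n x) \<longlonglongrightarrow> f x" by simp
qed

text \<open>
  The domain may be any measurable part of the square: a function on it is extended by zero, and the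
  expansion on the square is restricted afterwards. It is applied both to the aperture itself and to
  rescaled shifted apertures.
\<close>

lemma wave_expansion:
  assumes T: "0 < halfwidth P" and U: "U \<in> sets lebesgue" "U \<subseteq> square P" and f: "f \<in> L2 U"
  shows "L2_has_sum U 1 (\<lambda>(j, k) r. L2_inner U 1 f (wave P j k) * wave P j k r) f UNIV"
proof -
  let ?w = "\<lambda>i. wave P (fst i) (snd i)" and ?f = "\<lambda>x. indicator U x * f x"
  have f': "?f \<in> L2 (square P)" by (rule L2_zero_extension(1)[OF U(1) square_measurable U(2) f])
  have "L2_has_sum (square P) 1 (\<lambda>i r. L2_inner (square P) 1 ?f (?w i) * ?w i r) ?f UNIV"
  proof (rule L2_has_sum_orthonormal_basis[OF f' wave_L2_square])
    show "L2_inner (square P) 1 (?w i) (?w i') = (if i = i' then 1 else 0)" for i i'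
      using wave_orthonormal[OF T] by (auto simp: prod_eq_iff)
    fix \<epsilon> :: real assume "0 < \<epsilon>"
    with trig_approximable_L2[OF T f'] obtain t where
      t: "trig_poly P t" "L2_sqnorm (square P) (\<lambda>r. t r - ?f r) < \<epsilon>"
      unfolding trig_approximable_def by blast
    from trig_poly_expansion[OF t(1)] obtain F b where
      "finite F" "t = (\<lambda>r. \<Sum>i\<in>F. b i * ?w i r)" by blast
    with t(2) show "\<exists>F b. finite F \<and> F \<subseteq> UNIV \<and>
        L2_sqnorm (square P) (\<lambda>x. (\<Sum>i\<in>F. b i * ?w i x) - ?f x) < \<epsilon>" by auto
  qed
  from L2_has_sum_restrict[OF zero_less_one U(1) square_measurable U(2) this]
  have *: "L2_has_sum U 1 (\<lambda>i r. L2_inner (square P) 1 ?f (?w i) * ?w i r) ?f UNIV" .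
  have c: "L2_inner (square P) 1 ?f (?w i) = L2_inner U 1 f (?w i)" for i
  proof -
    have "indicator (square P) x *\<^sub>R (?f x * cnj (?w i x)) = indicator U x *\<^sub>R (f x * cnj (?w i x))" for x
      using U(2) by (auto simp: indicator_def)
    then show ?thesis
      using U(1) by (simp add: L2_inner_def integral_restrict_space)
  qed
  have "L2_has_sum U 1 (\<lambda>i r. L2_inner U 1 f (?w i) * ?w i r) f UNIV"
  proof (rule L2_has_sum_cong[OF zero_less_one *])
    show "(\<lambda>r. L2_inner U 1 f (?w i) * ?w i r) \<in> L2 U" for i
      by (intro L2_cmult L2_restrict[OF U(1) square_measurable U(2)] wave_L2_square)
    show "AE x in lebesgue_on U. f x = ?f x" using U(1) by (auto simp: AE_restrict_space_iff)
  qed (simp_all add: c f)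
  then show ?thesis by (simp add: case_prod_unfold)
qed

section \<open>Geometry of a layer\<close>

context tomography_setting
begin

abbreviation "shift l g \<equiv> height P l *\<^sub>R direction P g"

text \<open>
  Heights are nonnegative, as they increase from a nonnegative first one, and laser guide stars lie above
  all layers.
\<close>

lemma cone_factor_pos:
  assumes "l \<in> {1..layers P}"
  shows "0 < cone_factor P l g"
proof -
  have "height P 1 \<le> height P l"
    using assms height_less[of 1 l] by (cases "l = 1") auto
  then have "0 \<le> height P l" using height_nonneg by simp
  then show ?thesis
    using lgs_above[OF assms] by (simp add: cone_factor_def)
qed

lemma shifted_aperture_vimage:
  "shifted_aperture P l g = (\<lambda>r. (r - shift l g) /\<^sub>R cone_factor P l g) -` aperture P"
  by (auto simp: shifted_aperture_def)

lemma open_shifted_aperture: "open (shifted_aperture P l g)"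
  unfolding shifted_aperture_vimage
  by (intro open_vimage aperture_domain continuous_intros)

lemma open_layer_domain: "open (layer_domain P l)"
  unfolding layer_domain_def by (intro open_UN ballI open_shifted_aperture)

lemma aperture_measurable [simp]: "aperture P \<in> sets lebesgue"
  using aperture_domain by simp

lemma shifted_aperture_measurable [simp]: "shifted_aperture P l g \<in> sets lebesgue"
  using open_shifted_aperture by simp

lemma layer_domain_measurable [simp]: "layer_domain P l \<in> sets lebesgue"
  using open_layer_domain by simp

lemma shifted_aperture_subset: "g \<in> {1..stars P} \<Longrightarrow> shifted_aperture P l g \<subseteq> layer_domain P l"
  by (auto simp: layer_domain_def)

lemma overlay_ge_1:
  assumes "r \<in> layer_domain P l"
  shows "1 \<le> overlay P l r"
proof -
  obtain g where g: "g \<in> {1..stars P}" "r \<in> shifted_aperture P l g"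
    using assms by (auto simp: layer_domain_def)
  have "(indicator (shifted_aperture P l g) r :: real) \<le> overlay P l r"
    unfolding overlay_def by (rule member_le_sum) (use g in auto)
  with g show ?thesis by simp
qed

lemma overlay_measurable: "overlay P l \<in> borel_measurable (lebesgue_on \<Omega>)"
proof -
  have "indicator (shifted_aperture P l g) \<in> borel_measurable (lebesgue_on \<Omega>)" for g
    by (intro measurable_restrict_space1 borel_measurable_indicator) simp
  then show ?thesis unfolding overlay_def[abs_def] by (intro borel_measurable_sum)
qed

lemma inverse_overlay_bounded:
  "(\<lambda>r. of_real (c / overlay P l r) :: complex) \<in> borel_measurable (lebesgue_on (layer_domain P l))"
  "AE r in lebesgue_on (layer_domain P l). cmod (of_real (c / overlay P l r)) \<le> \<bar>c\<bar>"
proof -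
  show "(\<lambda>r. of_real (c / overlay P l r) :: complex) \<in> borel_measurable (lebesgue_on (layer_domain P l))"
    using overlay_measurable by measurable
  have "cmod (of_real (c / overlay P l r)) \<le> \<bar>c\<bar>" if "r \<in> layer_domain P l" for r
    using overlay_ge_1[OF that] mult_left_mono[of 1 "overlay P l r" "\<bar>c\<bar>"]
    by (simp add: norm_divide divide_le_eq)
  then show "AE r in lebesgue_on (layer_domain P l). cmod (of_real (c / overlay P l r)) \<le> \<bar>c\<bar>"
    by (simp add: AE_restrict_space_iff)
qed

section \<open>The frame of a layer and its dual\<close>

text \<open>
  The shifted aperture scaled back by its cone factor. It lies in the square, so the wave
  expansion holds on it, and dilating it gives the shifted aperture again. The trivial translation and the
  factor \<open>1 / c\<close> match the form of the affine substitution above.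
\<close>

definition scaled_domain :: "nat \<Rightarrow> nat \<Rightarrow> (real \<times> real) set" where
  "scaled_domain l g = (\<lambda>s. (s - 0) /\<^sub>R (1 / cone_factor P l g)) -` shifted_aperture P l g"

lemma scaled_domain_props:
  assumes "l \<in> {1..layers P}" "g \<in> {1..stars P}"
  shows "scaled_domain l g \<in> sets lebesgue" "scaled_domain l g \<subseteq> square P"
    "(\<lambda>r. (r - 0) /\<^sub>R cone_factor P l g) -` scaled_domain l g = shifted_aperture P l g"
proof -
  have c: "0 < cone_factor P l g" by (rule cone_factor_pos[OF assms(1)])
  show "scaled_domain l g \<in> sets lebesgue"
    unfolding scaled_domain_def by (rule sets_affine_vimage) (use c in simp_all)
  show "scaled_domain l g \<subseteq> square P"
  proof
    fix s assume "s \<in> scaled_domain l g"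
    then have "cone_factor P l g *\<^sub>R s \<in> shifted_aperture P l g" by (simp add: scaled_domain_def)
    then obtain q where "q \<in> square P" "cone_factor P l g *\<^sub>R s = cone_factor P l g *\<^sub>R q"
      using shifted_subset[OF assms] by blast
    then show "s \<in> square P" using c by simp
  qed
  show "(\<lambda>r. (r - 0) /\<^sub>R cone_factor P l g) -` scaled_domain l g = shifted_aperture P l g"
    using c by (simp add: scaled_domain_def vimage_def)
qed

lemma layer_wave_eq: "layer_wave P l (j, k, g) r = indicator (shifted_aperture P l g) r *
    (of_real (sqrt (weight P l) / cone_factor P l g) * wave P j k (r /\<^sub>R cone_factor P l g))"
  by (simp add: layer_wave_def)

lemma scaled_wave_L2:
  assumes "l \<in> {1..layers P}" "g \<in> {1..stars P}"
  shows "(\<lambda>r. wave P j k (r /\<^sub>R cone_factor P l g)) \<in> L2 (shifted_aperture P l g)"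
proof -
  note U = scaled_domain_props[OF assms]
  have "wave P j k \<in> L2 (scaled_domain l g)"
    by (rule L2_restrict[OF U(1) square_measurable U(2) wave_L2_square])
  from L2_affine(1)[OF cone_factor_pos[OF assms(1)] U(1) this, of g 0]
  show ?thesis unfolding U(3) by simp
qed

lemma layer_wave_L2:
  assumes "l \<in> {1..layers P}" "g \<in> {1..stars P}"
  shows "layer_wave P l (j, k, g) \<in> L2 (layer_domain P l)"
  unfolding layer_wave_eq[abs_def]
  by (intro L2_zero_extension(1) L2_cmult scaled_wave_L2 assms shifted_aperture_subset) simp_all

text \<open>
  Expand \<open>s \<mapsto> f (c s)\<close> in waves on the scaled domain and dilate. Substitution multiplies each
  Fourier coefficient by \<open>1 / c\<^sup>2\<close>, and this is precisely \<open>(1 / \<gamma>) (\<surd>\<gamma> / c)\<^sup>2\<close>, the product of the weight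
  of the inner product and the two normalising factors in the layer waves.
\<close>

lemma layer_wave_expansion:
  assumes l: "l \<in> {1..layers P}" and g: "g \<in> {1..stars P}" and f: "f \<in> L2 (layer_domain P l)"
  shows "L2_has_sum (layer_domain P l) (weight P l)
    (\<lambda>(j, k) r. L2_inner (layer_domain P l) (weight P l) f (layer_wave P l (j, k, g)) * layer_wave P l (j, k, g) r)
    (\<lambda>r. indicator (shifted_aperture P l g) r * f r) UNIV"
proof -
  let ?\<Omega> = "layer_domain P l" and ?S = "shifted_aperture P l g" and ?U = "scaled_domain l g"
  let ?c = "cone_factor P l g" and ?\<gamma> = "weight P l"
  let ?F = "\<lambda>s. f (?c *\<^sub>R s)"
  note U = scaled_domain_props[OF l g]
  have c: "0 < ?c" by (rule cone_factor_pos[OF l])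
  have \<gamma>: "0 < ?\<gamma>" by (rule weight_pos[OF l])
  have fS: "f \<in> L2 ?S"
    by (rule L2_restrict[OF _ _ shifted_aperture_subset[OF g] f]) simp_all
  have F: "?F \<in> L2 ?U"
    using L2_affine(1)[of "1 / ?c" ?S f 0] c fS by (simp add: scaled_domain_def)
  let ?I = "\<lambda>j k. L2_inner ?U 1 ?F (wave P j k)"
  have "L2_has_sum ?S 1 (\<lambda>i r. ?I (fst i) (snd i) * wave P (fst i) (snd i) (r /\<^sub>R ?c)) f UNIV"
    using L2_has_sum_affine[OF zero_less_one c U(1) wave_expansion[OF halfwidth_pos U(1,2) F], of 0] c
    unfolding U(3) by (simp add: case_prod_unfold)
  from L2_has_sum_zero_extension[OF \<gamma> _ _ shifted_aperture_subset[OF g] L2_has_sum_weight[OF zero_less_one \<gamma> this]]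
  have *: "L2_has_sum ?\<Omega> ?\<gamma>
      (\<lambda>i r. indicator ?S r * (?I (fst i) (snd i) * wave P (fst i) (snd i) (r /\<^sub>R ?c)))
      (\<lambda>r. indicator ?S r * f r) UNIV" by simp
  have coeff: "L2_inner ?\<Omega> ?\<gamma> f (layer_wave P l (j, k, g)) * layer_wave P l (j, k, g) r
      = indicator ?S r * (?I j k * wave P j k (r /\<^sub>R ?c))" for j k r
  proof -
    let ?h = "\<lambda>r. f r * cnj (wave P j k (r /\<^sub>R ?c))"
    have "?h \<in> borel_measurable (lebesgue_on ?S)"
      using L2_integrable_mult[OF fS scaled_wave_L2[OF l g]] by (rule borel_measurable_integrable)
    then have I: "?I j k = of_real (1 / ?c\<^sup>2) * (LINT r|lebesgue_on ?S. ?h r)"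
      using integral_affine[of "1 / ?c" ?S ?h 0] c
      by (simp add: L2_inner_def scaled_domain_def scaleR_conv_of_real power_divide power2_eq_square)
    have "f x * cnj (layer_wave P l (j, k, g) x)
        = of_real (sqrt ?\<gamma> / ?c) * (indicator ?S x * ?h x)" for x
      by (auto simp: layer_wave_eq indicator_def)
    from integral_zero_extension[OF shifted_aperture_measurable layer_domain_measurable
        shifted_aperture_subset[OF g] this]
    have "L2_inner ?\<Omega> ?\<gamma> f (layer_wave P l (j, k, g))
        = of_real (1 / ?\<gamma>) * (of_real (sqrt ?\<gamma> / ?c) * (LINT r|lebesgue_on ?S. ?h r))"
      unfolding L2_inner_def by (simp only:)
    then have "L2_inner ?\<Omega> ?\<gamma> f (layer_wave P l (j, k, g)) * layer_wave P l (j, k, g) r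
        = (of_real (1 / ?\<gamma>) * (of_real (sqrt ?\<gamma> / ?c) * of_real (sqrt ?\<gamma> / ?c))) *
          (indicator ?S r * ((LINT r|lebesgue_on ?S. ?h r) * wave P j k (r /\<^sub>R ?c)))"
      unfolding layer_wave_eq by (simp only: mult_ac)
    also have "of_real (1 / ?\<gamma>) * (of_real (sqrt ?\<gamma> / ?c) * of_real (sqrt ?\<gamma> / ?c)) = (of_real (1 / ?c\<^sup>2) :: complex)"
      unfolding of_real_mult[symmetric] of_real_eq_iff
      using \<gamma> c by (simp add: power2_eq_square)
    finally show ?thesis
      unfolding I by (simp only: mult_ac)
  qed
  show ?thesis
    unfolding case_prod_unfold coeff using * .
qed

text \<open>
  Summing the expansions over the guide stars: the frame operator is multiplication by the overlay
  function.
\<close>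

lemma layer_frame_expansion:
  assumes l: "l \<in> {1..layers P}" and f: "f \<in> L2 (layer_domain P l)"
  shows "L2_has_sum (layer_domain P l) (weight P l)
    (\<lambda>i r. L2_inner (layer_domain P l) (weight P l) f (layer_wave P l i) * layer_wave P l i r)
    (\<lambda>r. of_real (overlay P l r) * f r) (UNIV \<times> UNIV \<times> {1..stars P})"
proof -
  let ?f = "\<lambda>i r. L2_inner (layer_domain P l) (weight P l) f (layer_wave P l i) * layer_wave P l i r"
  let ?h = "\<lambda>g i. (fst i, snd i, g) :: int \<times> int \<times> nat"
  have "L2_has_sum (layer_domain P l) (weight P l) ?f
      (\<lambda>r. \<Sum>g = 1..stars P. indicator (shifted_aperture P l g) r * f r) (\<Union>g\<in>{1..stars P}. ?h g ` UNIV)"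
  proof (rule L2_has_sum_fibres)
    show "inj_on (\<lambda>(g, j). ?h g j) ({1..stars P} \<times> UNIV)"
      by (auto simp: inj_on_def)
    show "L2_has_sum (layer_domain P l) (weight P l) (\<lambda>i. ?f (?h g i))
        (\<lambda>r. indicator (shifted_aperture P l g) r * f r) UNIV" if "g \<in> {1..stars P}" for g
      using layer_wave_expansion[OF l that f] by (simp add: case_prod_unfold)
  qed (use weight_pos[OF l] in auto)
  moreover have "(\<Union>g\<in>{1..stars P}. ?h g ` UNIV) = UNIV \<times> UNIV \<times> {1..stars P}"
    by (auto simp: image_iff)
  moreover have "(\<Sum>g = 1..stars P. indicator (shifted_aperture P l g) r * f r) = of_real (overlay P l r) * f r" for r
    unfolding overlay_def by (simp add: sum_distrib_right of_real_indicator)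
  ultimately show ?thesis by (simp only:)
qed

text \<open>
  The overlay function is at least \<open>1\<close> on the layer domain, so the quotient is square-integrable and is a
  preimage of the layer wave under the frame operator. Every other preimage agrees with it almost everywhere,
  because it gives the layer wave when multiplied by the overlay function.
\<close>

lemma dual_layer_wave_eq:
  assumes l: "l \<in> {1..layers P}" and g: "g \<in> {1..stars P}"
  shows "dual_layer_wave P l (j, k, g) \<in> L2 (layer_domain P l)"
    and "AE r in lebesgue_on (layer_domain P l).
      dual_layer_wave P l (j, k, g) r = of_real (1 / overlay P l r) * layer_wave P l (j, k, g) r"
proof -
  let ?\<Omega> = "layer_domain P l" and ?e = "layer_wave P l (j, k, g)"
  let ?S = "frame_operator ?\<Omega> (weight P l) (layer_wave P l) (UNIV \<times> UNIV \<times> {1..stars P})"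
  let ?d = "\<lambda>r. of_real (1 / overlay P l r) * ?e r"
  have frame: "AE r in lebesgue_on ?\<Omega>. ?S f r = of_real (overlay P l r) * f r" if "f \<in> L2 ?\<Omega>" for f
    unfolding frame_operator_def
    by (rule L2_infsum_unique[OF weight_pos[OF l] layer_frame_expansion[OF l that]])
  have pos: "AE r in lebesgue_on ?\<Omega>. 1 \<le> overlay P l r"
    using overlay_ge_1 by (simp add: AE_restrict_space_iff)
  have d: "?d \<in> L2 ?\<Omega>"
  proof (rule L2_dominated(1))
    show "?e \<in> L2 ?\<Omega>" by (rule layer_wave_L2[OF l g])
    then show "?d \<in> borel_measurable (lebesgue_on ?\<Omega>)"
      by (intro borel_measurable_times L2_measurable inverse_overlay_bounded(1))
    show "AE r in lebesgue_on ?\<Omega>. cmod (?d r) \<le> \<bar>1\<bar> * cmod (?e r)"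
      using inverse_overlay_bounded(2)[of 1 l]
      by eventually_elim (simp only: norm_mult mult_right_mono norm_ge_zero)
  qed
  have "?d \<in> L2 ?\<Omega> \<and> (AE r in lebesgue_on ?\<Omega>. ?S ?d r = ?e r)"
    using d frame[OF d] pos by (auto elim: eventually_elim2)
  then have *: "dual_layer_wave P l (j, k, g) \<in> L2 ?\<Omega> \<and>
      (AE r in lebesgue_on ?\<Omega>. ?S (dual_layer_wave P l (j, k, g)) r = ?e r)"
    unfolding dual_layer_wave_def dual_frame_def
    by (rule someI[where P = "\<lambda>f. f \<in> L2 ?\<Omega> \<and> (AE r in lebesgue_on ?\<Omega>. ?S f r = ?e r)"])
  then show "dual_layer_wave P l (j, k, g) \<in> L2 ?\<Omega>" ..
  from *[THEN conjunct2] frame[OF *[THEN conjunct1]] pos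
  show "AE r in lebesgue_on ?\<Omega>. dual_layer_wave P l (j, k, g) r = ?d r"
    by eventually_elim (auto simp: field_simps)
qed

section \<open>The reconstruction operator\<close>

text \<open>
  Start from the expansion of each \<open>\<phi>\<^sub>g\<close> in waves on the aperture, move it to the shifted aperture by
  the substitution \<open>(r - a) / c\<close>, and multiply by the bounded function \<open>\<gamma> / ((c \<sigma>)\<^sup>2 2 T O)\<close>. Term by term,
  and up to null sets, this is the series that defines the reconstruction.
\<close>

lemma reconstruction_eq:
  assumes \<phi>: "\<phi> \<in> data_space P" and l: "l \<in> {1..layers P}"
  shows "AE r in lebesgue_on (layer_domain P l). reconstruction P \<phi> l r =
      (\<Sum>g = 1..stars P. of_real (weight P l / (cone_factor P l g * star_sigma P g)\<^sup>2) *
         \<phi> g ((r - height P l *\<^sub>R direction P g) /\<^sub>R cone_factor P l g) *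
         of_real (indicator (shifted_aperture P l g) r / overlay P l r))"
proof -
  let ?\<Omega> = "layer_domain P l" and ?\<gamma> = "weight P l" and ?T = "halfwidth P" and ?S = "shifted_aperture P l"
  let ?A = "\<lambda>g r. (r - shift l g) /\<^sub>R cone_factor P l g" and ?c = "cone_factor P l" and ?\<sigma> = "star_sigma P"
  have \<gamma>: "0 < ?\<gamma>" by (rule weight_pos[OF l])
  have c: "0 < ?c g" for g by (rule cone_factor_pos[OF l])
  let ?I = "\<lambda>g i. L2_inner (aperture P) 1 (\<phi> g) (wave P (fst i) (snd i))"
  let ?m = "\<lambda>g r. of_real (?\<gamma> / (?c g * ?\<sigma> g)\<^sup>2 / (2 * ?T) / overlay P l r) :: complex"
  let ?u = "\<lambda>g i r. ?m g r * (indicator (?S g) r * (?I g i * wave P (fst i) (snd i) (?A g r)))"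
  let ?s = "\<lambda>g r. ?m g r * (indicator (?S g) r * \<phi> g (?A g r))"
  have u: "L2_has_sum ?\<Omega> ?\<gamma> (?u g) (?s g) UNIV" if g: "g \<in> {1..stars P}" for g
  proof -
    have "\<phi> g \<in> L2 (aperture P)" using \<phi> g by (simp add: data_space_def)
    from wave_expansion[OF halfwidth_pos aperture_measurable aperture_subset this]
    have "L2_has_sum (aperture P) 1 (\<lambda>i r. ?I g i * wave P (fst i) (snd i) r) (\<phi> g) UNIV"
      by (simp add: case_prod_unfold)
    from L2_has_sum_affine[OF zero_less_one c aperture_measurable this, where a = "shift l g"]
    have "L2_has_sum (?S g) 1 (\<lambda>i r. ?I g i * wave P (fst i) (snd i) (?A g r)) (\<lambda>r. \<phi> g (?A g r)) UNIV"
      unfolding shifted_aperture_vimage .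
    from L2_has_sum_zero_extension[OF \<gamma> _ _ shifted_aperture_subset[OF g]
        L2_has_sum_weight[OF zero_less_one \<gamma> this]]
    show ?thesis
      by (intro L2_has_sum_mult[OF \<gamma> _ inverse_overlay_bounded]) simp
  qed
  let ?t = "\<lambda>g i r. of_real (sqrt ?\<gamma> / (?c g * (?\<sigma> g)\<^sup>2)) *
          wave P (fst i) (snd i) (- (shift l g /\<^sub>R ?c g)) *
          aperture_inner P (\<phi> g) (wave P (fst i) (snd i)) *
          dual_layer_wave P l (fst i, snd i, g) r"
  have "L2_has_sum ?\<Omega> ?\<gamma> (\<lambda>i r. \<Sum>g = 1..stars P. ?u g i r) (\<lambda>r. \<Sum>g = 1..stars P. ?s g r) UNIV"
    using u by (intro L2_has_sum_sum[OF \<gamma>]) auto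
  then have "L2_has_sum ?\<Omega> ?\<gamma> (\<lambda>i r. \<Sum>g = 1..stars P. ?t g i r) (\<lambda>r. \<Sum>g = 1..stars P. ?s g r) UNIV"
  proof (rule L2_has_sum_cong[OF \<gamma>])
    show "(\<lambda>r. \<Sum>g = 1..stars P. ?t g i r) \<in> L2 ?\<Omega>" for i
      using dual_layer_wave_eq(1)[OF l] by (intro L2_sum L2_cmult) auto
    show "(\<lambda>r. \<Sum>g = 1..stars P. ?s g r) \<in> L2 ?\<Omega>"
      using u[unfolded L2_has_sum_def] by (intro L2_sum) blast
    fix i
    have "AE r in lebesgue_on ?\<Omega>. \<forall>g\<in>{1..stars P}. dual_layer_wave P l (fst i, snd i, g) r
        = of_real (1 / overlay P l r) * layer_wave P l (fst i, snd i, g) r"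
      using dual_layer_wave_eq(2)[OF l] by (intro AE_finite_allI) auto
    then show "AE r in lebesgue_on ?\<Omega>. (\<Sum>g = 1..stars P. ?t g i r) = (\<Sum>g = 1..stars P. ?u g i r)"
    proof eventually_elim
      case (elim r)
      show ?case
      proof (rule sum.cong[OF refl])
        fix g assume g: "g \<in> {1..stars P}"
        let ?w = "wave P (fst i) (snd i)"
        have w: "?w (?A g r) = of_real (2 * ?T) * ?w (- (shift l g /\<^sub>R ?c g)) * ?w (r /\<^sub>R ?c g)"
          unfolding wave_shift[OF halfwidth_pos] by (simp add: scaleR_diff_right)
        \<comment> \<open>The factor \<open>2 T\<close> outside the series cancels against the one in the phase identity.\<close>
        have k: "of_real (sqrt ?\<gamma> / (?c g * (?\<sigma> g)\<^sup>2)) * of_real (sqrt ?\<gamma> / ?c g)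
            = (of_real (?\<gamma> / (?c g * ?\<sigma> g)\<^sup>2 / (2 * ?T)) * of_real (2 * ?T) :: complex)"
          unfolding of_real_mult[symmetric] of_real_eq_iff
          using \<gamma> halfwidth_pos by (simp add: power2_eq_square power_mult_distrib)
        have "?t g i r = (of_real (sqrt ?\<gamma> / (?c g * (?\<sigma> g)\<^sup>2)) * of_real (sqrt ?\<gamma> / ?c g)) *
            (?w (- (shift l g /\<^sub>R ?c g)) * ?I g i * of_real (1 / overlay P l r)
              * indicator (?S g) r * ?w (r /\<^sub>R ?c g))"
          using elim g unfolding layer_wave_eq aperture_inner_def by (simp only: mult_ac)
        also have "\<dots> = (of_real (?\<gamma> / (?c g * ?\<sigma> g)\<^sup>2 / (2 * ?T)) * of_real (1 / overlay P l r)) *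
            (indicator (?S g) r * (?I g i * ?w (?A g r)))"
          unfolding k w by (simp only: mult_ac)
        also have "\<dots> = ?u g i r" by (simp flip: of_real_mult)
        finally show "?t g i r = ?u g i r" .
      qed
    qed
  qed auto
  from L2_infsum_unique[OF \<gamma> this] show ?thesis
  proof eventually_elim
    case (elim r)
    then have "reconstruction P \<phi> l r = of_real (2 * ?T) * (\<Sum>g = 1..stars P. ?s g r)"
      by (simp add: reconstruction_def case_prod_unfold)
    also have "\<dots> = (\<Sum>g = 1..stars P. of_real (?\<gamma> / (?c g * ?\<sigma> g)\<^sup>2) * \<phi> g (?A g r) *
        of_real (indicator (?S g) r / overlay P l r))"
      unfolding sum_distrib_left
      using halfwidth_pos by (intro sum.cong refl) (simp add: of_real_indicator)
    finally show ?case .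
  qed
qed

section \<open>The adjoint of the tomography operator\<close>

definition explicit_adj :: "nat \<Rightarrow> (real \<times> real \<Rightarrow> complex) \<Rightarrow> nat \<Rightarrow> real \<times> real \<Rightarrow> complex" where
  "explicit_adj g f l r = indicator (shifted_aperture P l g) r *
     (of_real (weight P l / (cone_factor P l g)\<^sup>2) * f ((r - shift l g) /\<^sub>R cone_factor P l g))"

lemma shifted_L2:
  assumes "l \<in> {1..layers P}" "f \<in> L2 (aperture P)"
  shows "(\<lambda>r. f ((r - shift l g) /\<^sub>R cone_factor P l g)) \<in> L2 (shifted_aperture P l g)"
  unfolding shifted_aperture_vimage
  by (rule L2_affine(1)[OF cone_factor_pos[OF assms(1)] aperture_measurable assms(2)])

lemma explicit_adj_in_layer_space:
  assumes "g \<in> {1..stars P}" "f \<in> L2 (aperture P)"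
  shows "explicit_adj g f \<in> layer_space P"
  unfolding layer_space_def explicit_adj_def[abs_def]
  by (intro CollectI ballI L2_zero_extension(1) L2_cmult shifted_L2 shifted_aperture_subset assms) simp_all

text \<open>
  Substitute \<open>r = c s + a\<close> in each layer: the Jacobian \<open>c\<^sup>2\<close> and the weight \<open>1 / \<gamma>\<close> of the inner product
  of the layer account for the factor \<open>\<gamma> / c\<^sup>2\<close>.
\<close>

lemma explicit_adj_inner:
  assumes g: "g \<in> {1..stars P}" and f: "f \<in> L2 (aperture P)" and z: "z \<in> layer_space P"
  shows "aperture_inner P (tomography_op P g z) f = layer_inner P z (explicit_adj g f)"
proof -
  let ?B = "\<lambda>l s. cone_factor P l g *\<^sub>R s + shift l g"
  have *: "(\<lambda>s. z l (?B l s)) \<in> L2 (aperture P) \<and>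
      L2_inner (aperture P) 1 (\<lambda>s. z l (?B l s)) f
        = L2_inner (layer_domain P l) (weight P l) (z l) (explicit_adj g f l)"
    if l: "l \<in> {1..layers P}" for l
  proof -
    let ?c = "cone_factor P l g" and ?S = "shifted_aperture P l g"
    have c: "0 < ?c" by (rule cone_factor_pos[OF l])
    have \<gamma>: "0 < weight P l" by (rule weight_pos[OF l])
    have B: "(s - (- shift l g /\<^sub>R ?c)) /\<^sub>R (1 / ?c) = ?B l s" for s
      using c by (simp add: scaleR_add_right)
    have inv: "(?B l s - shift l g) /\<^sub>R ?c = s" for s using c by simp
    have vim: "?B l -` ?S = aperture P"
      using inv by (auto simp: shifted_aperture_def)
    have zS: "z l \<in> L2 ?S"
      using z l by (intro L2_restrict[OF _ _ shifted_aperture_subset[OF g]]) (auto simp: layer_space_def)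
    have z': "(\<lambda>s. z l (?B l s)) \<in> L2 (aperture P)"
      by (rule L2_affine(1)[of "1 / ?c" ?S "z l" "- shift l g /\<^sub>R ?c", unfolded B vim, OF _ _ zS])
        (use c in simp_all)
    let ?h = "\<lambda>r. z l r * cnj (f ((r - shift l g) /\<^sub>R ?c))"
    have h: "?h \<in> borel_measurable (lebesgue_on ?S)"
      using L2_integrable_mult[OF zS shifted_L2[OF l f]] by (rule borel_measurable_integrable)
    have "L2_inner (aperture P) 1 (\<lambda>s. z l (?B l s)) f = (LINT s|lebesgue_on (?B l -` ?S). ?h (?B l s))"
      unfolding L2_inner_def vim inv by simp
    also have "\<dots> = (1 / ?c) ^ DIM(real \<times> real) *\<^sub>R (LINT r|lebesgue_on ?S. ?h r)"
      by (rule integral_affine[of "1 / ?c" ?S ?h "- shift l g /\<^sub>R ?c", unfolded B, OF _ _ h])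
        (use c in simp_all)
    also have "\<dots> = of_real (1 / weight P l) * (of_real (weight P l / ?c\<^sup>2) * (LINT r|lebesgue_on ?S. ?h r))"
      using \<gamma> by (simp add: scaleR_conv_of_real power_divide power2_eq_square)
    also have "\<dots> = L2_inner (layer_domain P l) (weight P l) (z l) (explicit_adj g f l)"
    proof -
      have "z l r * cnj (explicit_adj g f l r)
          = of_real (weight P l / ?c\<^sup>2) * (indicator ?S r * ?h r)" for r
        by (auto simp: explicit_adj_def indicator_def)
      from integral_zero_extension[OF shifted_aperture_measurable layer_domain_measurable
          shifted_aperture_subset[OF g] this]
      show ?thesis unfolding L2_inner_def by (simp only:)
    qed
    finally show ?thesis using z' by blast
  qed
  have "aperture_inner P (tomography_op P g z) f
      = (\<Sum>l = 1..layers P. L2_inner (aperture P) 1 (\<lambda>s. z l (?B l s)) f)"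
    unfolding aperture_inner_def tomography_op_def[abs_def]
    using * f by (intro L2_inner_sum_left) auto
  also have "\<dots> = layer_inner P z (explicit_adj g f)"
    unfolding layer_inner_def using * by (intro sum.cong refl) blast
  finally show ?thesis .
qed

text \<open>
  Test with the difference of the two elements in one layer and with zero in all others.
\<close>

lemma layer_inner_ext:
  assumes x: "x \<in> layer_space P" and y: "y \<in> layer_space P"
    and eq: "\<And>z. z \<in> layer_space P \<Longrightarrow> layer_inner P z x = layer_inner P z y"
    and l: "l \<in> {1..layers P}"
  shows "AE r in lebesgue_on (layer_domain P l). x l r = y l r"
proof -
  let ?\<Omega> = "layer_domain P l" and ?I = "L2_inner (layer_domain P l) (weight P l)"
  let ?d = "\<lambda>r. x l r - y l r"
  have xy: "x l \<in> L2 ?\<Omega>" "y l \<in> L2 ?\<Omega>" using x y l by (auto simp: layer_space_def)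
  have d: "?d \<in> L2 ?\<Omega>" using xy by (rule L2_diff(1))
  define z where "z m = (if m = l then ?d else (\<lambda>_. 0))" for m
  have z: "z \<in> layer_space P" using d by (auto simp: z_def layer_space_def)
  have single: "layer_inner P z v = ?I ?d (v l)" for v
  proof -
    have "layer_inner P z v = (\<Sum>m = 1..layers P. if m = l then ?I ?d (v l) else 0)"
      unfolding layer_inner_def z_def by (intro sum.cong refl) (auto simp: L2_inner_def)
    also have "\<dots> = ?I ?d (v l)" using l by (simp add: sum.delta)
    finally show ?thesis .
  qed
  have "?I (x l) ?d = ?I (y l) ?d"
    using eq[OF z] L2_inner_commute[of ?\<Omega> "weight P l" "x l" ?d]
      L2_inner_commute[of ?\<Omega> "weight P l" "y l" ?d] unfolding single by (simp only:)
  then have "?I ?d ?d = 0"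
    using L2_inner_add_left[OF xy(1) L2_uminus[OF xy(2)] d, of "weight P l"]
      L2_inner_cmult_left[of ?\<Omega> "weight P l" "-1" "y l" ?d] by simp
  then have "L2_norm ?\<Omega> (weight P l) ?d = 0" by (simp add: L2_norm_def)
  then have "L2_sqnorm ?\<Omega> ?d = 0" using weight_pos[OF l] by (simp add: L2_norm_eq)
  from L2_sqnorm_eq_0[OF d this] show ?thesis by simp
qed

lemma tomography_adj_eq:
  assumes g: "g \<in> {1..stars P}" and f: "f \<in> L2 (aperture P)" and l: "l \<in> {1..layers P}"
  shows "AE r in lebesgue_on (layer_domain P l). tomography_adj P g f l r = explicit_adj g f l r"
proof -
  have "explicit_adj g f \<in> layer_space P \<and>
      (\<forall>z\<in>layer_space P. aperture_inner P (tomography_op P g z) f = layer_inner P z (explicit_adj g f))"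
    using explicit_adj_in_layer_space[OF g f] explicit_adj_inner[OF g f] by blast
  then have "tomography_adj P g f \<in> layer_space P \<and>
      (\<forall>z\<in>layer_space P. aperture_inner P (tomography_op P g z) f = layer_inner P z (tomography_adj P g f))"
    unfolding tomography_adj_def adjoint_wrt_def
    by (rule someI[where P = "\<lambda>x. x \<in> layer_space P \<and>
      (\<forall>z\<in>layer_space P. aperture_inner P (tomography_op P g z) f = layer_inner P z x)"])
  then show ?thesis
    using explicit_adj_in_layer_space[OF g f] explicit_adj_inner[OF g f] l
    by (intro layer_inner_ext) auto
qed

lemma reconstruction_adj_eq:
  assumes \<phi>: "\<phi> \<in> data_space P" and l: "l \<in> {1..layers P}"
  shows "AE r in lebesgue_on (layer_domain P l).
    (\<Sum>g = 1..stars P. of_real (weight P l / (cone_factor P l g * star_sigma P g)\<^sup>2) *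
         \<phi> g ((r - height P l *\<^sub>R direction P g) /\<^sub>R cone_factor P l g) *
         of_real (indicator (shifted_aperture P l g) r / overlay P l r)) =
      (\<Sum>g = 1..stars P. of_real (1 / ((star_sigma P g)\<^sup>2 * overlay P l r)) *
         tomography_adj P g (\<phi> g) l r)"
proof -
  have "AE r in lebesgue_on (layer_domain P l). \<forall>g\<in>{1..stars P}.
      tomography_adj P g (\<phi> g) l r = explicit_adj g (\<phi> g) l r"
    using \<phi> l by (intro AE_finite_allI tomography_adj_eq) (auto simp: data_space_def)
  then show ?thesis
  proof eventually_elim
    case (elim r)
    show ?case
    proof (rule sum.cong[OF refl])
      fix g assume "g \<in> {1..stars P}"
      with elim have adj: "tomography_adj P g (\<phi> g) l r = explicit_adj g (\<phi> g) l r" by blast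
      show "of_real (weight P l / (cone_factor P l g * star_sigma P g)\<^sup>2) *
          \<phi> g ((r - shift l g) /\<^sub>R cone_factor P l g) *
          of_real (indicator (shifted_aperture P l g) r / overlay P l r) =
        of_real (1 / ((star_sigma P g)\<^sup>2 * overlay P l r)) * tomography_adj P g (\<phi> g) l r"
        unfolding adj explicit_adj_def
        by (simp add: of_real_indicator power_mult_distrib mult_ac)
    qed
  qed
qed

end

theorem theorem4p6:
  fixes P :: tomography and \<phi> :: "nat \<Rightarrow> real \<times> real \<Rightarrow> complex"
  assumes "tomography_setting P"
    and "\<phi> \<in> data_space P"
  shows "\<forall>l\<in>{1..layers P}. AE r in lebesgue_on (layer_domain P l).
    reconstruction P \<phi> l r =
      (\<Sum>g = 1..stars P. of_real (weight P l / (cone_factor P l g * star_sigma P g)\<^sup>2) *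
         \<phi> g ((r - height P l *\<^sub>R direction P g) /\<^sub>R cone_factor P l g) *
         of_real (indicator (shifted_aperture P l g) r / overlay P l r)) \<and>
    (\<Sum>g = 1..stars P. of_real (weight P l / (cone_factor P l g * star_sigma P g)\<^sup>2) *
         \<phi> g ((r - height P l *\<^sub>R direction P g) /\<^sub>R cone_factor P l g) *
         of_real (indicator (shifted_aperture P l g) r / overlay P l r)) =
      (\<Sum>g = 1..stars P. of_real (1 / ((star_sigma P g)\<^sup>2 * overlay P l r)) *
         tomography_adj P g (\<phi> g) l r)"
proof
  interpret tomography_setting P by fact
  fix l assume l: "l \<in> {1..layers P}"
  show "AE r in lebesgue_on (layer_domain P l).
    reconstruction P \<phi> l r =
      (\<Sum>g = 1..stars P. of_real (weight P l / (cone_factor P l g * star_sigma P g)\<^sup>2) *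
         \<phi> g ((r - height P l *\<^sub>R direction P g) /\<^sub>R cone_factor P l g) *
         of_real (indicator (shifted_aperture P l g) r / overlay P l r)) \<and>
    (\<Sum>g = 1..stars P. of_real (weight P l / (cone_factor P l g * star_sigma P g)\<^sup>2) *
         \<phi> g ((r - height P l *\<^sub>R direction P g) /\<^sub>R cone_factor P l g) *
         of_real (indicator (shifted_aperture P l g) r / overlay P l r)) =
      (\<Sum>g = 1..stars P. of_real (1 / ((star_sigma P g)\<^sup>2 * overlay P l r)) *
         tomography_adj P g (\<phi> g) l r)"
    by (rule AE_conjI[OF reconstruction_eq[OF assms(2) l] reconstruction_adj_eq[OF assms(2) l]])
qed

end
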